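(* Let $B$ be the open unit disk. Let $\Phi:\partial B\to\gamma$ be an orientation preserving $C^1$ diffeomorphism onto a simple closed curve $\gamma$, $D$ the bounded domain with $\partial D=\gamma$, and $U\in C^2(B;\mathbb R^2)\cap C(\overline B;\mathbb R^2)$ the solution of $\Delta U=0$ in $B$, $U=\Phi$ on $\partial B$, and assume $U\in C^1(\overline B;\mathbb R^2)$. Then $U$ is a diffeomorphism of $\overline B$ onto $\overline D$ if and only if $\det DU>0$ everywhere on $\Phi^{-1}(\gamma_{nc})$.
   Context: For the Jordan domain $D$, let $\mathrm{co}(D)$ be its convex hull. The convex part of $\partial D$ is $\gamma_c=\partial D\cap\partial(\mathrm{co}(D))$, and the non-convex part is the open set $\gamma_{nc}=\partial D\setminus\partial(\mathrm{co}(D))$. *)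

theory Defs
  imports "HOL-Complex_Analysis.Complex_Analysis"
begin

text \<open>The plane R^2 is identified with the complex numbers.\<close>

definition C1_on :: "complex set \<Rightarrow> (complex \<Rightarrow> complex) \<Rightarrow> bool" where
  "C1_on S f \<longleftrightarrow> (\<exists>f' :: complex \<Rightarrow> complex \<Rightarrow>\<^sub>L complex.
      (\<forall>x\<in>S. (f has_derivative blinfun_apply (f' x)) (at x within S)) \<and> continuous_on S f')"

definition C2_on :: "complex set \<Rightarrow> (complex \<Rightarrow> complex) \<Rightarrow> bool" where
  "C2_on S f \<longleftrightarrow> (\<exists>(f' :: complex \<Rightarrow> complex \<Rightarrow>\<^sub>L complex)
                        (f'' :: complex \<Rightarrow> complex \<Rightarrow>\<^sub>L complex \<Rightarrow>\<^sub>L complex).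
      (\<forall>x\<in>S. (f has_derivative blinfun_apply (f' x)) (at x within S)) \<and>
      (\<forall>x\<in>S. (f' has_derivative blinfun_apply (f'' x)) (at x within S)) \<and>
      continuous_on S f'')"

definition laplacian :: "(complex \<Rightarrow> complex) \<Rightarrow> complex \<Rightarrow> complex" where
  "laplacian U z =
     frechet_derivative (\<lambda>w. frechet_derivative U (at w) 1) (at z) 1 +
     frechet_derivative (\<lambda>w. frechet_derivative U (at w) \<i>) (at z) \<i>"

definition jacobian_det :: "complex set \<Rightarrow> (complex \<Rightarrow> complex) \<Rightarrow> complex \<Rightarrow> real" where
  "jacobian_det S U z =
     (let Ux = frechet_derivative U (at z within S) 1;
          Uy = frechet_derivative U (at z within S) \<i>
      in Re Ux * Im Uy - Re Uy * Im Ux)"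

definition diffeo_onto :: "complex set \<Rightarrow> complex set \<Rightarrow> (complex \<Rightarrow> complex) \<Rightarrow> bool" where
  "diffeo_onto S T f \<longleftrightarrow> (\<exists>g. f ` S = T \<and> (\<forall>x\<in>S. g (f x) = x) \<and> (\<forall>y\<in>T. f (g y) = y) \<and>
                              C1_on S f \<and> C1_on T g)"

definition nonconvex_part :: "complex set \<Rightarrow> complex set" where
  "nonconvex_part D = frontier D - frontier (convex hull D)"

end

theory Submission
  imports Defs
begin

text \<open>
  Write \<open>DU(h) = a h + b cnj h\<close>. Since \<open>U\<close> is harmonic, \<open>a\<close> and \<open>cnj b\<close> are holomorphic in the disc,
  and \<open>det DU = |a|^2 - |b|^2\<close>. At a boundary point mapped to \<open>\<partial>(co D)\<close> there is a supporting line with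
  outer normal \<open>n\<close>; the Hopf lemma for the harmonic function \<open>n \<bullet> U\<close> makes the normal component of the
  radial derivative positive, the tangential derivative is a positive multiple of \<open>\<i> n\<close> by the
  orientation of \<open>\<gamma>\<close>, and hence \<open>det DU > 0\<close> there. So the condition on the non-convex part gives
  \<open>|b| < |a|\<close> on the whole circle. Because \<open>\<Phi>' = \<i> (a z - b cnj z)\<close> along the circle, the loop \<open>a\<close> has
  winding number equal to the turning number of \<open>\<gamma>\<close> minus 1, which is 0 by the Umlaufsatz;
  thus \<open>a\<close> has no zeros, and the maximum principle for \<open>cnj b / a\<close> yields \<open>det DU > 0\<close> in the closed disc.
  A local diffeomorphism of the closed disc that is injective on the boundary is then globally
  injective, since the set of points sharing their value with another point is open and closed.
\<close>

section \<open>Wirtinger derivatives\<close>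

text \<open>The orientation is given only as winding number 1 around the points of \<open>D\<close>,
  whereas the Hopf argument needs the direction of the tangent at a support point. The bridge is a
  comparison with the unit circle: a loop with counterclockwise tangent at a support point winds
  once around a point slightly inside of it. If the tangent were reversed, the reversed loop would
  have this property, and the original loop would wind -1 times around some point, which would have
  to lie in \<open>D\<close>. The quotient of a chord of the curve by the corresponding chord of the
  circle serves this comparison as well as the Umlaufsatz; dividing by the circle is what removes 1
  from the turning number. For the converse direction, a diffeomorphism has nonvanishing determinant
  on the connected closed disc, and the sign is read off at a rightmost point of the curve. At the
  circle all derivatives are taken within the closed disc.\<close>

definition wirt :: "(complex \<Rightarrow>\<^sub>L complex) \<Rightarrow> complex" where
  "wirt A = (blinfun_apply A 1 - \<i> * blinfun_apply A \<i>) / 2"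

definition wirt_bar :: "(complex \<Rightarrow>\<^sub>L complex) \<Rightarrow> complex" where
  "wirt_bar A = (blinfun_apply A 1 + \<i> * blinfun_apply A \<i>) / 2"

lemma blinfun_apply_Re_Im:
  "blinfun_apply A h = Re h *\<^sub>R blinfun_apply A 1 + Im h *\<^sub>R blinfun_apply A \<i>"
proof -
  have "h = Re h *\<^sub>R 1 + Im h *\<^sub>R \<i>"
    by (simp add: complex_eq_iff)
  then show ?thesis
    by (metis blinfun.add_right blinfun.scaleR_right)
qed

lemma blinfun_apply_wirt: "blinfun_apply A h = wirt A * h + wirt_bar A * cnj h"
  unfolding blinfun_apply_Re_Im[of A h] wirt_def wirt_bar_def
  by (simp add: complex_eq_iff field_simps)

lemma continuous_on_wirt:
  assumes "continuous_on S f"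
  shows "continuous_on S (\<lambda>x. wirt (f x))" "continuous_on S (\<lambda>x. wirt_bar (f x))"
  unfolding wirt_def wirt_bar_def by (intro continuous_intros assms ballI; simp)+

text \<open>Mean value inequality along one side of a parallelogram: both values of
  \<open>f'\<close> that occur are compared with its linearization at the single point
  \<open>x\<close>. The second difference is symmetric in \<open>u\<close> and \<open>v\<close>,
  which is what forces the symmetry of \<open>f''\<close>.\<close>

lemma second_difference_estimate:
  fixes f :: "'a::real_normed_vector \<Rightarrow> 'b::real_normed_vector"
    and f' :: "'a \<Rightarrow> 'a \<Rightarrow>\<^sub>L 'b" and f'' :: "'a \<Rightarrow> 'a \<Rightarrow>\<^sub>L 'b"
  assumes S: "open S" "x \<in> S"
    and f: "\<And>y. y \<in> S \<Longrightarrow> (f has_derivative blinfun_apply (f' y)) (at y)"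
    and f': "(f' has_derivative f'') (at x)"
    and e: "e > 0"
  shows "\<exists>d>0. \<forall>h. 0 < h \<and> h < d \<longrightarrow>
     norm (f (x + h *\<^sub>R u + h *\<^sub>R v) - f (x + h *\<^sub>R u) - f (x + h *\<^sub>R v) + f x - (h^2) *\<^sub>R blinfun_apply (f'' u) v)
       \<le> e * h^2"
proof -
  \<comment> \<open>The derivative of \<open>\<phi>\<close> will be bounded by \<open>e / K\<close>
    times \<open>h^2\<close> times \<open>K - 1\<close>; the summand 1 keeps \<open>K\<close>
    positive when \<open>v = 0\<close>.\<close>
  define K where "K = 2 * (norm u + norm v) * norm v + 1"
  have K: "K > 0" by (simp add: K_def add_nonneg_pos)
  interpret f'': bounded_linear f'' using f' by (rule has_derivative_bounded_linear)
  have eK: "e / K > 0" using e K by simp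
  obtain d1 where d1: "d1 > 0" "\<And>y. norm (y - x) < d1 \<Longrightarrow>
      norm (f' y - f' x - f'' (y - x)) \<le> e / K * norm (y - x)"
    using f' eK unfolding has_derivative_at_alt by metis
  obtain d2 where d2: "d2 > 0" "ball x d2 \<subseteq> S"
    using S openE by blast
  define m where "m = norm u + norm v + 1"
  have m: "m > 0" by (simp add: m_def add_nonneg_pos)
  define d where "d = min d1 d2 / m"
  have d: "d > 0" using d1 d2 m by (simp add: d_def)
  show ?thesis
  proof (intro exI conjI allI impI)
    show "d > 0" by fact
    fix h :: real assume h: "0 < h \<and> h < d"
    have hm: "h * m < d1" "h * m < d2"
      using h m by (auto simp: d_def field_simps)
    have le: "norm (h *\<^sub>R u + (s * h) *\<^sub>R v) \<le> h * (norm u + norm v)"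
      "norm ((s * h) *\<^sub>R v) \<le> h * (norm u + norm v)" if "s \<in> {0..1}" for s
    proof -
      have sh: "s * h \<le> h" "0 \<le> s * h" using h that by (auto intro: mult_left_le_one_le)
      have sv: "norm ((s * h) *\<^sub>R v) \<le> h * norm v" using sh by (simp add: mult_right_mono)
      have hu: "norm (h *\<^sub>R u) = h * norm u" using h by simp
      show "norm (h *\<^sub>R u + (s * h) *\<^sub>R v) \<le> h * (norm u + norm v)"
        using norm_triangle_ineq[of "h *\<^sub>R u" "(s * h) *\<^sub>R v"] sv hu by (simp only: distrib_left)
      show "norm ((s * h) *\<^sub>R v) \<le> h * (norm u + norm v)"
        using sv h norm_ge_zero[of u] by (simp add: distrib_left add_increasing)
    qed
    have hm': "h * (norm u + norm v) < h * m" using h by (simp add: m_def)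
    have ball: "x + (h *\<^sub>R u + (s * h) *\<^sub>R v) \<in> S" "x + (s * h) *\<^sub>R v \<in> S" if "s \<in> {0..1}" for s
    proof -
      have mem: "x + w \<in> S" if "norm w < d2" for w
        using that by (auto intro!: subsetD[OF d2(2)] simp: dist_norm)
      show "x + (h *\<^sub>R u + (s * h) *\<^sub>R v) \<in> S" "x + (s * h) *\<^sub>R v \<in> S"
        using le[OF that] hm hm' by (auto intro!: mem)
    qed
    \<comment> \<open>\<open>\<phi> 1 - \<phi> 0\<close> is the second difference minus its expected
      value, so a bound on the derivative in \<open>s\<close> suffices.\<close>
    define \<phi> where "\<phi> s = f (x + (h *\<^sub>R u + (s * h) *\<^sub>R v)) - f (x + (s * h) *\<^sub>R v)
        - (s * h^2) *\<^sub>R blinfun_apply (f'' u) v" for s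
    define \<phi>' where "\<phi>' s = h *\<^sub>R blinfun_apply (f' (x + (h *\<^sub>R u + (s * h) *\<^sub>R v))) v
        - h *\<^sub>R blinfun_apply (f' (x + (s * h) *\<^sub>R v)) v - (h^2) *\<^sub>R blinfun_apply (f'' u) v" for s
    have der: "(\<phi> has_derivative (\<lambda>k. k *\<^sub>R \<phi>' s)) (at s within {0..1})" if s: "s \<in> {0..1}" for s
    proof -
      have 1: "((\<lambda>s. f (x + (h *\<^sub>R u + (s * h) *\<^sub>R v))) has_derivative
          (\<lambda>k. blinfun_apply (f' (x + (h *\<^sub>R u + (s * h) *\<^sub>R v))) ((k * h) *\<^sub>R v))) (at s within {0..1})"
        by (rule has_derivative_compose[where f = "\<lambda>s. x + (h *\<^sub>R u + (s * h) *\<^sub>R v)", OF _ f[OF ball(1)[OF s]]])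
            (auto intro!: derivative_eq_intros)
      have 2: "((\<lambda>s. f (x + (s * h) *\<^sub>R v)) has_derivative
          (\<lambda>k. blinfun_apply (f' (x + (s * h) *\<^sub>R v)) ((k * h) *\<^sub>R v))) (at s within {0..1})"
        by (rule has_derivative_compose[where f = "\<lambda>s. x + (s * h) *\<^sub>R v", OF _ f[OF ball(2)[OF s]]])
            (auto intro!: derivative_eq_intros)
      show ?thesis unfolding \<phi>_def
        apply (rule has_derivative_eq_rhs)
         apply (rule derivative_intros 1 2)+
        apply (auto simp: \<phi>'_def blinfun.scaleR_right algebra_simps)
        done
    qed
    have bnd: "norm (\<phi>' s) \<le> e * h^2" if s: "s \<in> {0..1}" for s
    proof -
      define R where "R y = f' y - f' x - f'' (y - x)" for y
      let ?a = "h *\<^sub>R u + (s * h) *\<^sub>R v" and ?b = "(s * h) *\<^sub>R v"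
      have R1: "norm (R (x + ?a)) \<le> e / K * norm ?a"
        unfolding R_def using d1(2)[of "x + ?a"] le(1)[OF s] hm hm' by simp
      also have "\<dots> \<le> e / K * (h * (norm u + norm v))"
        by (rule mult_left_mono[OF le(1)[OF s]]) (use eK in simp)
      finally have R1: "norm (R (x + ?a)) \<le> e / K * (h * (norm u + norm v))" .
      have R2: "norm (R (x + ?b)) \<le> e / K * norm ?b"
        unfolding R_def using d1(2)[of "x + ?b"] le(2)[OF s] hm hm' by simp
      also have "\<dots> \<le> e / K * (h * (norm u + norm v))"
        by (rule mult_left_mono[OF le(2)[OF s]]) (use eK in simp)
      finally have R2: "norm (R (x + ?b)) \<le> e / K * (h * (norm u + norm v))" .
      have "R (x + ?a) - R (x + ?b) = f' (x + ?a) - f' (x + ?b) - h *\<^sub>R f'' u"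
        unfolding R_def by (simp add: f''.add f''.scaleR)
      then have "\<phi>' s = h *\<^sub>R blinfun_apply (R (x + ?a) - R (x + ?b)) v"
        unfolding \<phi>'_def by (simp add: blinfun.diff_left blinfun.scaleR_left scaleR_diff_right power2_eq_square)
      then have "norm (\<phi>' s) = h * norm (blinfun_apply (R (x + ?a) - R (x + ?b)) v)"
        using h by simp
      also have "\<dots> \<le> h * (norm (R (x + ?a) - R (x + ?b)) * norm v)"
        using h by (intro mult_left_mono norm_blinfun) auto
      also have "\<dots> \<le> h * ((e / K * (h * (norm u + norm v)) + e / K * (h * (norm u + norm v))) * norm v)"
        using h by (intro mult_left_mono mult_right_mono order_trans[OF norm_triangle_ineq4 add_mono[OF R1 R2]]) auto
      also have "\<dots> = (e * h^2) * ((K - 1) / K)"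
        by (simp add: K_def power2_eq_square field_simps)
      also have "\<dots> \<le> (e * h^2) * 1"
        using K e by (intro mult_left_mono) auto
      finally show ?thesis by simp
    qed
    have "norm (\<phi> 1 - \<phi> 0) \<le> (e * h^2) * norm (1 - 0 :: real)"
    proof (rule differentiable_bound[OF _ der])
      fix s :: real assume s: "s \<in> {0..1}"
      show "onorm (\<lambda>k. k *\<^sub>R \<phi>' s) \<le> e * h\<^sup>2"
        using bnd[OF s] by (intro onorm_le) (simp add: mult.commute mult_left_mono)
    qed auto
    moreover have "\<phi> 1 - \<phi> 0 = f (x + h *\<^sub>R u + h *\<^sub>R v) - f (x + h *\<^sub>R u) - f (x + h *\<^sub>R v) + f x
        - (h^2) *\<^sub>R blinfun_apply (f'' u) v"
      by (simp add: \<phi>_def algebra_simps)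
    ultimately show "norm (f (x + h *\<^sub>R u + h *\<^sub>R v) - f (x + h *\<^sub>R u) - f (x + h *\<^sub>R v) + f x
        - (h^2) *\<^sub>R blinfun_apply (f'' u) v) \<le> e * h^2"
      by simp
  qed
qed

lemma second_derivative_symmetric:
  fixes f :: "'a::real_normed_vector \<Rightarrow> 'b::real_normed_vector"
    and f' :: "'a \<Rightarrow> 'a \<Rightarrow>\<^sub>L 'b" and f'' :: "'a \<Rightarrow> 'a \<Rightarrow>\<^sub>L 'b"
  assumes S: "open S" "x \<in> S"
    and f: "\<And>y. y \<in> S \<Longrightarrow> (f has_derivative blinfun_apply (f' y)) (at y)"
    and f': "(f' has_derivative f'') (at x)"
  shows "blinfun_apply (f'' u) v = blinfun_apply (f'' v) u"
proof -
  have "norm (blinfun_apply (f'' u) v - blinfun_apply (f'' v) u) \<le> 0 + e" if e: "e > 0" for e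
  proof -
    have e2: "e / 2 > 0" using e by simp
    obtain d1 where d1: "d1 > 0" "\<And>h. 0 < h \<and> h < d1 \<Longrightarrow>
      norm (f (x + h *\<^sub>R u + h *\<^sub>R v) - f (x + h *\<^sub>R u) - f (x + h *\<^sub>R v) + f x - (h^2) *\<^sub>R blinfun_apply (f'' u) v)
       \<le> e/2 * h^2"
      using second_difference_estimate[OF S f f' e2] by metis
    obtain d2 where d2: "d2 > 0" "\<And>h. 0 < h \<and> h < d2 \<Longrightarrow>
      norm (f (x + h *\<^sub>R v + h *\<^sub>R u) - f (x + h *\<^sub>R v) - f (x + h *\<^sub>R u) + f x - (h^2) *\<^sub>R blinfun_apply (f'' v) u)
       \<le> e/2 * h^2"
      using second_difference_estimate[OF S f f' e2] by metis
    define h where "h = min d1 d2 / 2"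
    have h: "0 < h" "h < d1" "h < d2" using d1(1) d2(1) by (auto simp: h_def)
    define D where "D = f (x + h *\<^sub>R u + h *\<^sub>R v) - f (x + h *\<^sub>R u) - f (x + h *\<^sub>R v) + f x"
    have 1: "norm (D - (h^2) *\<^sub>R blinfun_apply (f'' u) v) \<le> e/2 * h^2"
      using d1(2)[of h] h unfolding D_def by blast
    have 2: "norm (D - (h^2) *\<^sub>R blinfun_apply (f'' v) u) \<le> e/2 * h^2"
      using d2(2)[of h] h unfolding D_def by (simp add: algebra_simps)
    have "norm ((D - (h^2) *\<^sub>R blinfun_apply (f'' v) u) - (D - (h^2) *\<^sub>R blinfun_apply (f'' u) v)) \<le> e * h^2"
      using 1 2 norm_triangle_ineq4[of "D - (h^2) *\<^sub>R blinfun_apply (f'' v) u" "D - (h^2) *\<^sub>R blinfun_apply (f'' u) v"]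
      by (simp add: field_simps)
    moreover have "(D - (h^2) *\<^sub>R blinfun_apply (f'' v) u) - (D - (h^2) *\<^sub>R blinfun_apply (f'' u) v)
        = (h^2) *\<^sub>R (blinfun_apply (f'' u) v - blinfun_apply (f'' v) u)"
      by (simp add: algebra_simps)
    ultimately have "h^2 * norm (blinfun_apply (f'' u) v - blinfun_apply (f'' v) u) \<le> h^2 * e"
      by (simp add: mult.commute)
    then show ?thesis using h by simp
  qed
  then have "norm (blinfun_apply (f'' u) v - blinfun_apply (f'' v) u) \<le> 0"
    by (rule field_le_epsilon)
  then show ?thesis by simp
qed

text \<open>The Laplacian is four times the mixed second Wirtinger derivative. Symmetry of
  \<open>f''\<close> identifies the two mixed partials, and harmonicity then yields the
  Cauchy-Riemann equations for both functions.\<close>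

lemma harmonic_imp_wirt_holomorphic:
  fixes f' :: "complex \<Rightarrow> complex \<Rightarrow>\<^sub>L complex" and f'' :: "complex \<Rightarrow> complex \<Rightarrow>\<^sub>L complex \<Rightarrow>\<^sub>L complex"
  assumes S: "open S"
    and f: "\<And>x. x \<in> S \<Longrightarrow> (U has_derivative blinfun_apply (f' x)) (at x)"
    and f': "\<And>x. x \<in> S \<Longrightarrow> (f' has_derivative blinfun_apply (f'' x)) (at x)"
    and harm: "\<And>x. x \<in> S \<Longrightarrow> laplacian U x = 0"
  shows "(\<lambda>x. wirt (f' x)) holomorphic_on S" "(\<lambda>x. cnj (wirt_bar (f' x))) holomorphic_on S"
proof -
  have *: "(\<exists>c. ((\<lambda>x. wirt (f' x)) has_field_derivative c) (at x)) \<and>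
           (\<exists>c. ((\<lambda>x. cnj (wirt_bar (f' x))) has_field_derivative c) (at x))" if x: "x \<in> S" for x
  proof -
    define A where "A h k = blinfun_apply (blinfun_apply (f'' x) h) k" for h k
    have fd: "frechet_derivative U (at w) = blinfun_apply (f' w)" if "w \<in> S" for w
      using frechet_derivative_at[OF f[OF that]] by simp
    have pd: "((\<lambda>w. blinfun_apply (f' w) k) has_derivative (\<lambda>h. A h k)) (at x)" for k
      using bounded_linear.has_derivative[OF blinfun.bounded_linear_left f'[OF x]] by (simp add: A_def)
    have "((\<lambda>w. frechet_derivative U (at w) k) has_derivative (\<lambda>h. A h k)) (at x)" for k
      by (rule has_derivative_transform_within_open[OF pd S x]) (simp add: fd)
    then have "frechet_derivative (\<lambda>w. frechet_derivative U (at w) k) (at x) = (\<lambda>h. A h k)" for k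
      by (rule frechet_derivative_at[symmetric])
    then have lap: "A 1 1 + A \<i> \<i> = 0"
      using harm[OF x] by (simp add: laplacian_def)
    have sym: "A 1 \<i> = A \<i> 1"
      unfolding A_def by (rule second_derivative_symmetric[OF S x f f'[OF x]])
    have lin: "A h k = Re h *\<^sub>R A 1 k + Im h *\<^sub>R A \<i> k" for h k
      unfolding A_def
    proof -
      have "h = Re h *\<^sub>R 1 + Im h *\<^sub>R \<i>"
        by (simp add: complex_eq_iff)
      then have "blinfun_apply (f'' x) h = Re h *\<^sub>R blinfun_apply (f'' x) 1 + Im h *\<^sub>R blinfun_apply (f'' x) \<i>"
        by (metis blinfun.add_right blinfun.scaleR_right)
      then show "blinfun_apply (blinfun_apply (f'' x) h) k = Re h *\<^sub>R blinfun_apply (blinfun_apply (f'' x) 1) k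
          + Im h *\<^sub>R blinfun_apply (blinfun_apply (f'' x) \<i>) k"
        by (simp add: blinfun.add_left blinfun.scaleR_left)
    qed
    have Aii: "A \<i> \<i> = - A 1 1" using lap by (simp add: add_eq_0_iff)
    have 1: "((\<lambda>w. wirt (f' w)) has_derivative (\<lambda>h. (A h 1 - \<i> * A h \<i>) / 2)) (at x)"
      unfolding wirt_def
      by (rule bounded_linear.has_derivative[OF bounded_linear_divide
            has_derivative_diff[OF pd has_derivative_mult_right[OF pd]]])
    have 1: "((\<lambda>w. wirt (f' w)) has_field_derivative (A 1 1 - \<i> * A 1 \<i>) / 2) (at x)"
      unfolding has_field_derivative_def
      by (rule has_derivative_eq_rhs[OF 1])
        (rule ext, subst lin[of _ 1], subst lin[of _ \<i>], simp add: Aii sym complex_eq_iff field_simps)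
    have 2: "((\<lambda>w. cnj (wirt_bar (f' w))) has_derivative (\<lambda>h. cnj ((A h 1 + \<i> * A h \<i>) / 2))) (at x)"
      unfolding wirt_bar_def
      by (rule has_derivative_cnj[OF bounded_linear.has_derivative[OF bounded_linear_divide
            has_derivative_add[OF pd has_derivative_mult_right[OF pd]]]])
    have 2: "((\<lambda>w. cnj (wirt_bar (f' w))) has_field_derivative cnj ((A 1 1 + \<i> * A 1 \<i>) / 2)) (at x)"
      unfolding has_field_derivative_def
      by (rule has_derivative_eq_rhs[OF 2])
        (rule ext, subst lin[of _ 1], subst lin[of _ \<i>], simp add: Aii sym complex_eq_iff field_simps)
    show ?thesis using 1 2 by blast
  qed
  show "(\<lambda>x. wirt (f' x)) holomorphic_on S" "(\<lambda>x. cnj (wirt_bar (f' x))) holomorphic_on S"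
    using * by (auto simp: holomorphic_on_open[OF S])
qed

section \<open>The Hopf boundary point lemma\<close>

text \<open>In the right half-plane the first hypothesis describes a pseudohyperbolic disc of radius
  \<open>r\<close> about \<open>p\<close>. The imaginary parts add the same \<open>d\<close> to both
  squared norms, and \<open>r < 1\<close> allows dropping it. The factor \<open>1 + r\<close> that
  remains is weakened to 2.\<close>

lemma Cayley_bound:
  fixes w p :: complex
  assumes le: "norm (w - p) \<le> r * norm (w + cnj p)" and r: "0 \<le> r" "r < 1"
    and w: "Re w \<ge> 0" and p: "Re p > 0"
  shows "Re p * (1 - r) / 2 \<le> Re w"
proof -
  define d where "d = (Im w - Im p)^2"
  have "(norm (w - p))^2 \<le> (r * norm (w + cnj p))^2"
    using le by (rule power_mono) simp
  then have "(Re w - Re p)^2 + d \<le> r^2 * ((Re w + Re p)^2 + d)"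
    by (simp add: power_mult_distrib cmod_power2 d_def)
  moreover have "r^2 * d \<le> 1 * d"
    using r by (intro mult_right_mono) (auto simp: d_def power_le_one)
  ultimately have "(Re w - Re p)^2 \<le> (r * (Re w + Re p))^2"
    by (simp only: power_mult_distrib distrib_left[of "r^2"])
  then have "\<bar>Re w - Re p\<bar> \<le> r * (Re w + Re p)"
    using r w p unfolding abs_le_square_iff[symmetric] by simp
  then have *: "Re p * (1 - r) \<le> Re w * (1 + r)"
    by (simp add: algebra_simps)
  also have "\<dots> \<le> Re w * 2" using r w by (intro mult_left_mono) auto
  finally show ?thesis by simp
qed

text \<open>A Cayley transform centred at \<open>- H 0\<close> turns \<open>- H\<close> into a
  self-map of the disc fixing 0. The Schwarz lemma then bounds \<open>- Re H\<close> from below by a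
  positive multiple of \<open>1 - r\<close> on the radius to \<open>m\<close>, and such a linear
  bound forces a nonzero slope at \<open>m\<close>.\<close>

lemma Hopf_boundary_point:
  assumes H: "\<And>x. x \<in> cball 0 1 \<Longrightarrow> (H has_field_derivative H' x) (at x within cball 0 1)"
    and le: "\<And>x. x \<in> sphere 0 1 \<Longrightarrow> Re (H x) \<le> 0"
    and m: "norm m = 1" "Re (H m) = 0"
    and nz: "\<exists>x\<in>cball 0 1. Re (H x) \<noteq> 0"
  shows "Re (H' m * m) > 0"
proof -
  have cont: "continuous_on (cball 0 1) H"
    unfolding continuous_on_eq_continuous_within using H DERIV_continuous by blast
  have hol: "H holomorphic_on ball 0 1"
  proof -
    have "\<And>x. x \<in> ball 0 1 \<Longrightarrow> (H has_field_derivative H' x) (at x within ball 0 1)"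
      by (meson H DERIV_subset ball_subset_cball subsetD)
    then show ?thesis unfolding holomorphic_on_def field_differentiable_def by blast
  qed
  have le0: "Re (H x) \<le> 0" if "x \<in> cball 0 1" for x
    using maximum_real_frontier[of H "cball 0 1" 0 x] hol cont le that by auto
  have lt: "Re (H x) < 0" if x: "x \<in> ball 0 1" for x
  proof (rule ccontr)
    assume "\<not> Re (H x) < 0"
    then have x0: "Re (H x) = 0" using le0[of x] x by auto
    \<comment> \<open>The modulus of \<open>exp H\<close> is \<open>exp (Re H)\<close>, so an
      interior zero of \<open>Re H\<close> is an interior maximum of this modulus.\<close>
    have "(\<lambda>z. exp (H z)) constant_on ball 0 1"
      by (rule maximum_modulus_principle[where U = "ball 0 1" and \<xi> = x])
        (use x x0 le0 in \<open>auto intro!: holomorphic_intros hol\<close>)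
    then obtain c where c: "\<And>z. z \<in> ball 0 1 \<Longrightarrow> exp (H z) = c"
      by (auto simp: constant_on_def)
    have z0: "Re (H z) = 0" if "z \<in> ball 0 1" for z
    proof -
      have "norm (exp (H z)) = norm (exp (H x))" using c[OF x] c[OF that] by simp
      then show ?thesis using x0 by simp
    qed
    have "Re (H z) = 0" if "z \<in> cball 0 1" for z
    proof (rule continuous_constant_on_closure[where S = "ball 0 1" and f = "\<lambda>z. Re (H z)"])
      show "continuous_on (closure (ball 0 1)) (\<lambda>z. Re (H z))"
        using cont by (auto intro!: continuous_intros)
    qed (use that z0 in auto)
    then show False using nz by blast
  qed
  define p where "p = - H 0"
  have p: "Re p > 0" using lt[of 0] by (simp add: p_def)
  define g where "g z = (- H z - p) / (- H z + cnj p)" for z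
  have den: "- H z + cnj p \<noteq> 0" if "z \<in> ball 0 1" for z
  proof
    assume "- H z + cnj p = 0"
    then have "Re (- H z + cnj p) = 0" by simp
    then show False using lt[OF that] p by simp
  qed
  have g: "norm (g z) \<le> norm z" if z: "norm z < 1" for z
  proof (rule Schwarz_Lemma(1))
    show "g holomorphic_on ball 0 1"
      unfolding g_def using den by (intro holomorphic_intros hol) auto
    show "g 0 = 0" by (simp add: g_def p_def)
    show "norm (g z) < 1" if "norm z < 1" for z
    proof -
      have z: "z \<in> ball 0 1" using that by simp
      have "(norm (- H z - p))^2 < (norm (- H z + cnj p))^2"
        unfolding cmod_power2 using lt[OF z] p
        by (simp add: power2_eq_square algebra_simps mult_neg_pos mult_pos_neg)
      then have "norm (- H z - p) < norm (- H z + cnj p)"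
        by (rule power_less_imp_less_base) simp
      then show ?thesis using den[OF z] by (simp add: g_def norm_divide divide_less_eq)
    qed
  qed (use z in auto)
  have low: "Re p * (1 - r) / 2 \<le> - Re (H (of_real r * m))" if r: "0 \<le> r" "r < 1" for r
  proof -
    have rm: "norm (of_real r * m) = r" using m r by (simp add: norm_mult)
    then have b: "of_real r * m \<in> ball 0 1" using r by simp
    have "norm (- H (of_real r * m) - p) \<le> r * norm (- H (of_real r * m) + cnj p)"
      using g[of "of_real r * m"] rm r den[OF b] by (simp add: g_def norm_divide divide_le_eq)
    from Cayley_bound[OF this r _ p] show ?thesis using lt[OF b] by simp
  qed
  \<comment> \<open>\<open>k\<close> is nonpositive on [0, 1) by \<open>low\<close> and vanishes at
    1, so its left derivative at 1 is nonnegative.\<close>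
  define k where "k r = Re (H (of_real r * m)) + Re p * (1 - r) / 2" for r
  have "((\<lambda>r. H (of_real r * m)) has_vector_derivative (m * H' m)) (at 1 within {0..1})"
  proof -
    have "((\<lambda>r. of_real r * m) has_vector_derivative m) (at 1 within {0..1::real})"
      by (auto intro!: derivative_eq_intros)
    moreover have "(H has_field_derivative H' m) (at (of_real 1 * m) within (\<lambda>r. of_real r * m) ` {0..1})"
      using H[of m] m by (auto intro!: DERIV_subset[of H _ _ "cball 0 1"] simp: norm_mult)
    ultimately show ?thesis
      using field_vector_diff_chain_within[of "\<lambda>r. of_real r * m" m 1 "{0..1}" H "H' m"] by (simp add: o_def)
  qed
  then have "((\<lambda>r. Re (H (of_real r * m))) has_vector_derivative (Re (m * H' m))) (at 1 within {0..1})"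
    by (rule bounded_linear.has_vector_derivative[OF bounded_linear_Re])
  then have 1: "((\<lambda>r. Re (H (of_real r * m))) has_field_derivative (Re (m * H' m))) (at 1 within {0..1})"
    by (simp only: has_real_derivative_iff_has_vector_derivative)
  have 2: "((\<lambda>r. Re p * (1 - r) / 2) has_field_derivative (- Re p / 2)) (at 1 within {0..1})"
    by (auto intro!: derivative_eq_intros)
  have "(k has_field_derivative (Re (m * H' m) - Re p / 2)) (at 1 within {0..1})"
    unfolding k_def using DERIV_add[OF 1 2] by simp
  then have "((\<lambda>r. (k r - k 1) / (r - 1)) \<longlongrightarrow> (Re (m * H' m) - Re p / 2)) (at 1 within {0..1})"
    by (simp add: has_field_derivative_iff)
  moreover have "\<forall>\<^sub>F r in at 1 within {0..1}. 0 \<le> (k r - k 1) / (r - 1)"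
    unfolding eventually_at_filter
  proof (intro always_eventually allI impI)
    fix r :: real assume "r \<noteq> 1" "r \<in> {0..1}"
    then have r: "0 \<le> r" "r < 1" by auto
    have "k 1 = 0" using m by (simp add: k_def)
    moreover have "k r \<le> 0" using low[OF r] by (simp add: k_def)
    ultimately show "0 \<le> (k r - k 1) / (r - 1)" using r by (simp add: divide_nonpos_neg)
  qed
  moreover have "at 1 within {0..1::real} \<noteq> bot"
    by (simp add: at_within_Icc_at_left)
  ultimately have "0 \<le> Re (m * H' m) - Re p / 2"
    by (rule tendsto_lowerbound)
  then show ?thesis using p by (simp add: mult.commute)
qed

section \<open>Harmonic maps of the disc that are C1 up to the circle\<close>

locale harmonic_disc =
  fixes U a b :: "complex \<Rightarrow> complex"
  assumes der: "\<And>x. x \<in> cball 0 1 \<Longrightarrow> (U has_derivative (\<lambda>h. a x * h + b x * cnj h)) (at x within cball 0 1)"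
    and cont_a: "continuous_on (cball 0 1) a" and cont_b: "continuous_on (cball 0 1) b"
    and hol_a: "a holomorphic_on ball 0 1" and hol_b: "(\<lambda>x. cnj (b x)) holomorphic_on ball 0 1"
begin

lemma cont_U: "continuous_on (cball 0 1) U"
  by (rule has_derivative_continuous_on) (rule der)

text \<open>\<open>Re (cnj n * w)\<close> is the inner product of the vectors \<open>n\<close> and
  \<open>w\<close>. The derivative of \<open>H\<close> is chosen so that \<open>Re H\<close> has the
  same differential as this component of \<open>U\<close>; convexity of the closed disc supplies the
  primitive up to the circle, and a real constant adjusts its value.\<close>

lemma holomorphic_component:
  obtains H where
    "\<And>x. x \<in> cball 0 1 \<Longrightarrow> (H has_field_derivative (cnj n * a x + n * cnj (b x))) (at x within cball 0 1)"
    "\<And>x. x \<in> cball 0 1 \<Longrightarrow> Re (H x) = Re (cnj n * (U x - p))"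
proof -
  let ?h = "\<lambda>x. cnj n * a x + n * cnj (b x)"
  obtain H where H: "\<And>x. x \<in> cball 0 1 \<Longrightarrow> (H has_field_derivative ?h x) (at x within cball 0 1)"
  proof (rule holomorphic_convex_primitive[of "cball 0 1" "{}" ?h])
    show "continuous_on (cball 0 1) ?h"
      by (intro continuous_intros cont_a cont_b)
    have "?h holomorphic_on ball 0 1"
      by (intro holomorphic_intros hol_a hol_b)
    then show "?h field_differentiable at x" if "x \<in> interior (cball 0 1) - {}" for x
      using that by (auto intro: holomorphic_on_imp_differentiable_at)
  qed auto
  have "((\<lambda>x. Re (H x) - Re (cnj n * (U x - p))) has_derivative (\<lambda>_. 0)) (at x within cball 0 1)"
    if "x \<in> cball 0 1" for x
    by (rule has_derivative_eq_rhs[OF has_derivative_diff[OF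
            has_derivative_Re[OF H[OF that, unfolded has_field_derivative_def]]
            has_derivative_Re[OF has_derivative_mult_right[OF has_derivative_diff[OF der[OF that] has_derivative_const]]]]])
      (simp add: fun_eq_iff algebra_simps)
  then obtain c where c: "\<And>x. x \<in> cball 0 1 \<Longrightarrow> Re (H x) - Re (cnj n * (U x - p)) = c"
    using has_derivative_zero_constant[of "cball 0 1" "\<lambda>x. Re (H x) - Re (cnj n * (U x - p))"] by auto
  show thesis
  proof
    show "((\<lambda>x. H x - of_real c) has_field_derivative ?h x) (at x within cball 0 1)" if "x \<in> cball 0 1" for x
      using H[OF that] by (auto intro!: derivative_eq_intros)
    show "Re (H x - of_real c) = Re (cnj n * (U x - p))" if "x \<in> cball 0 1" for x
      using c[OF that] by (simp only: minus_complex.sel Re_complex_of_real)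
  qed
qed

lemma normal_derivative_pos:
  assumes le: "\<And>x. x \<in> sphere 0 1 \<Longrightarrow> Re (cnj n * (U x - U m)) \<le> 0"
    and m: "norm m = 1" and nz: "\<exists>x\<in>sphere 0 1. Re (cnj n * (U x - U m)) \<noteq> 0"
  shows "Re (cnj n * (a m * m + b m * cnj m)) > 0"
proof -
  obtain H where H: "\<And>x. x \<in> cball 0 1 \<Longrightarrow> (H has_field_derivative (cnj n * a x + n * cnj (b x))) (at x within cball 0 1)"
    and eq: "\<And>x. x \<in> cball 0 1 \<Longrightarrow> Re (H x) = Re (cnj n * (U x - U m))"
    using holomorphic_component by blast
  have s: "x \<in> cball 0 1" if "x \<in> sphere 0 1" for x :: complex using that by auto
  have "Re ((cnj n * a m + n * cnj (b m)) * m) > 0"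
  proof (rule Hopf_boundary_point[OF H])
    show "\<exists>x\<in>cball 0 1. Re (H x) \<noteq> 0" using nz eq s by fastforce
  qed (use m le eq s in auto)
  then show ?thesis by (simp add: algebra_simps)
qed

end

section \<open>Winding numbers and the Umlaufsatz\<close>

text \<open>Slit-plane tests are made on quotients, while linear homotopies ask for segments that
  avoid 0; this translates between the two.\<close>

lemma zero_in_closed_segment_imp_quotient_nonpos:
  fixes x y :: complex
  assumes "0 \<in> closed_segment x y" "x \<noteq> 0"
  shows "y / x \<in> \<real>\<^sub>\<le>\<^sub>0"
proof -
  obtain u where u: "0 \<le> u" "u \<le> 1" "(1 - u) *\<^sub>R x + u *\<^sub>R y = 0"
    using assms(1) unfolding in_segment by metis
  have "u \<noteq> 0" using u assms(2) by auto
  then have "y / x = of_real (- ((1 - u) / u))"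
  proof -
    have "of_real u * y = - (of_real (1 - u) * x)"
      using u(3) by (simp add: scaleR_conv_of_real add_eq_0_iff)
    then show ?thesis using \<open>u \<noteq> 0\<close> assms(2) by (simp add: field_simps)
  qed
  then show ?thesis using u by (simp only: nonpos_Reals_of_real_iff) (simp add: divide_nonneg_nonneg)
qed

text \<open>The factors \<open>exp (s * Ln k)\<close> lead from 1 to \<open>k\<close> without
  passing through 0.\<close>

lemma winding_number_mult_left:
  assumes "path \<gamma>" "pathfinish \<gamma> = pathstart \<gamma>" "0 \<notin> path_image \<gamma>" "k \<noteq> 0"
  shows "winding_number (\<lambda>t. k * \<gamma> t) 0 = winding_number \<gamma> 0"
proof (rule winding_number_homotopic_loops[symmetric])
  have "continuous_on {0..1} \<gamma>" using assms(1) by (simp add: path_def)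
  then have c: "continuous_on ({0..1} \<times> {0..1}) (\<lambda>y. \<gamma> (snd y))"
    by (rule continuous_on_compose2) (auto intro!: continuous_intros)
  show "homotopic_loops (- {0}) \<gamma> (\<lambda>t. k * \<gamma> t)"
    unfolding homotopic_loops
  proof (intro exI conjI)
    let ?h = "\<lambda>y :: real \<times> real. exp (of_real (fst y) * Ln k) * \<gamma> (snd y)"
    show "continuous_on ({0..1} \<times> {0..1}) ?h"
      by (intro continuous_intros c)
    show "?h \<in> ({0..1} \<times> {0..1}) \<rightarrow> - {0}"
      using assms(3) by (auto simp: path_image_def)
  qed (use assms in \<open>auto simp: pathfinish_def pathstart_def\<close>)
qed

text \<open>The diagonal is a removable singularity: the mean value inequality compares nearby chord
  quotients with \<open>g' t0\<close>, because \<open>g'\<close> varies little around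
  \<open>t0\<close>.\<close>

lemma continuous_on_difference_quotient:
  fixes g :: "real \<Rightarrow> 'a::real_normed_vector"
  assumes deriv_g: "\<And>t. (g has_vector_derivative g' t) (at t)" and cont_deriv: "continuous_on UNIV g'"
  shows "continuous_on UNIV (\<lambda>(s, t). if s = t then g' t else (g t - g s) /\<^sub>R (t - s))"
    (is "continuous_on UNIV ?q")
proof -
  have contg: "continuous_on UNIV g"
    by (intro continuous_at_imp_continuous_on ballI has_vector_derivative_continuous[OF deriv_g])
  have off: "continuous_on {p. fst p \<noteq> snd p} ?q"
  proof (rule continuous_on_eq)
    show "continuous_on {p. fst p \<noteq> snd p} (\<lambda>p. (g (snd p) - g (fst p)) /\<^sub>R (snd p - fst p))"
      by (intro continuous_intros continuous_on_compose2[OF contg]) auto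
  qed auto
  have op: "open {p :: real \<times> real. fst p \<noteq> snd p}"
    by (intro open_Collect_neq continuous_intros)
  have "isCont ?q p" for p
  proof (cases "fst p = snd p")
    case False
    then show ?thesis using off op continuous_on_eq_continuous_at by blast
  next
    case True
    then obtain t0 where p: "p = (t0, t0)" by (metis prod.collapse)
    show ?thesis
      unfolding continuous_at_eps_delta p
    proof (intro allI impI)
      fix e :: real assume e: "e > 0"
      have "isCont g' t0" using cont_deriv by (simp add: continuous_on_eq_continuous_at)
      then obtain d where d: "d > 0" "\<And>x. dist x t0 < d \<Longrightarrow> dist (g' x) (g' t0) < e / 2"
        unfolding continuous_at_eps_delta using e half_gt_zero by metis
      have "dist (?q x) (?q (t0, t0)) < e" if x: "dist x (t0, t0) < d" for x
      proof -
        obtain s t where st: "x = (s, t)" by fastforce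
        have s: "dist s t0 < d" using order_le_less_trans[OF dist_fst_le x] by (simp add: st)
        have t: "dist t t0 < d" using order_le_less_trans[OF dist_snd_le x] by (simp add: st)
        show ?thesis
        proof (cases "s = t")
          case True
          then show ?thesis using d(2)[OF t] e st by simp
        next
          case False
          have "norm (g t - g s - (t - s) *\<^sub>R g' t0) \<le> norm (t - s) * (e / 2)"
          proof (rule vector_differentiable_bound_linearization)
            show "closed_segment s t \<subseteq> ball t0 d"
              using s t by (intro closed_segment_subset) (auto simp: dist_commute)
            show "norm (g' x - g' t0) \<le> e / 2" if "x \<in> ball t0 d" for x
            proof -
              have "dist (g' x) (g' t0) < e / 2" using d(2)[of x] that by (simp add: dist_commute)
              then show ?thesis by (simp add: dist_norm)
            qed
          qed (use deriv_g d(1) in \<open>auto intro: has_vector_derivative_at_within\<close>)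
          moreover have "g t - g s - (t - s) *\<^sub>R g' t0 = (t - s) *\<^sub>R ((g t - g s) /\<^sub>R (t - s) - g' t0)"
            using False by (simp add: scaleR_diff_right)
          ultimately have "norm ((g t - g s) /\<^sub>R (t - s) - g' t0) \<le> e / 2"
            using False by simp
          then show ?thesis using False e st by (simp add: dist_norm)
        qed
      qed
      then show "\<exists>d>0. \<forall>x. dist x (t0, t0) < d \<longrightarrow> dist (?q x) (?q (t0, t0)) < e"
        using d(1) by blast
    qed
  qed
  then show ?thesis by (simp add: continuous_at_imp_continuous_on)
qed

lemma has_vector_derivative_cis: "(cis has_vector_derivative \<i> * cis t) (at t)"
  unfolding cis_conv_exp
  by (rule has_vector_derivative_eq_rhs, rule field_vector_diff_chain_at[of _ \<i> t exp, unfolded o_def])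
    (auto intro!: derivative_eq_intros)

lemma cis_eq_imp_eq:
  assumes "cis s = cis t" "\<bar>s - t\<bar> < 2 * pi"
  shows "s = t"
proof -
  have "sin s = sin t \<and> cos s = cos t"
    using assms(1) by (auto simp: complex_eq_iff)
  then obtain k :: int where k: "s = t + 2 * pi * of_int k"
    unfolding sin_cos_eq_iff by (auto simp: mult_ac)
  then have "2 * pi * \<bar>of_int k\<bar> < 2 * pi * (1 :: real)" using assms(2) by (simp add: abs_mult)
  then have "\<bar>of_int k\<bar> < (1 :: real)" by (simp only: mult_less_cancel_left) auto
  then have "k = 0" by linarith
  then show ?thesis using k by simp
qed

text \<open>The loop is a function of the angle on the whole real line; \<open>g_eq_iff\<close>
  encodes at once the period \<open>2 * pi\<close> and injectivity on the circle.\<close>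

locale smooth_jordan_loop =
  fixes g g' :: "real \<Rightarrow> complex"
  assumes deriv_g: "\<And>t. (g has_vector_derivative g' t) (at t)"
    and cont_deriv: "continuous_on UNIV g'"
    and regular: "\<And>t. g' t \<noteq> 0"
    and g_eq_iff: "\<And>s t. g s = g t \<longleftrightarrow> cis s = cis t"
begin

lemma cont_g: "continuous_on UNIV g"
  by (intro continuous_at_imp_continuous_on ballI has_vector_derivative_continuous[OF deriv_g])

lemma deriv_periodic:
  assumes "cis s = cis t"
  shows "g' s = g' t"
proof -
  have "cis (s - t) = 1"
    using assms by (simp flip: cis_divide)
  then have eq: "g (x + (s - t)) = g x" for x
    unfolding g_eq_iff by (simp flip: cis_mult)
  have "((g \<circ> (\<lambda>x. x + (s - t))) has_vector_derivative (1 *\<^sub>R g' s)) (at t)"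
    using deriv_g[of s] by (intro vector_diff_chain_at) (auto intro!: derivative_eq_intros)
  then have "(g has_vector_derivative g' s) (at t)"
    by (simp add: o_def eq)
  then show ?thesis
    using deriv_g vector_derivative_unique_at by blast
qed

text \<open>The chord quotient extends continuously to the torus and is symmetric there; on the
  diagonal it is the tangent divided by the tangent of the circle.\<close>

definition chord_ratio :: "real \<Rightarrow> real \<Rightarrow> complex" where
  "chord_ratio s t = (if cis s = cis t then g' t / (\<i> * cis t) else (g t - g s) / (cis t - cis s))"

lemma chord_ratio_mult: "chord_ratio s t * (cis t - cis s) = g t - g s"
  using g_eq_iff[of s t] by (cases "cis s = cis t") (simp_all add: chord_ratio_def)

lemma chord_ratio_nonzero: "chord_ratio s t \<noteq> 0"
  using regular[of t] g_eq_iff[of s t] by (cases "cis s = cis t") (simp_all add: chord_ratio_def)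

lemma chord_ratio_commute: "chord_ratio s t = chord_ratio t s"
proof (cases "cis s = cis t")
  case True
  then show ?thesis using deriv_periodic[OF True] by (simp add: chord_ratio_def)
next
  case False
  have "(g t - g s) / (cis t - cis s) = (g s - g t) / (cis s - cis t)"
    using minus_divide_divide[of "g s - g t" "cis s - cis t"] by simp
  then show ?thesis using False by (simp add: chord_ratio_def)
qed

lemma chord_ratio_periodic:
  assumes "cis t = cis t'"
  shows "chord_ratio s t = chord_ratio s t'"
  using assms g_eq_iff[of t t'] deriv_periodic[of t t'] by (simp add: chord_ratio_def)

text \<open>Numerator and denominator are each divided by \<open>t - s\<close>, which makes both
  continuous across the diagonal. In this strip \<open>cis s = cis t\<close> holds on the diagonal
  only, so the new denominator \<open>r\<close> has no zeros.\<close>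

lemma isCont_chord_ratio_aux:
  assumes "\<bar>fst p - snd p\<bar> < 2 * pi"
  shows "isCont (\<lambda>(s, t). chord_ratio s t) p"
proof -
  define S where "S = {p :: real \<times> real. \<bar>fst p - snd p\<bar> < 2 * pi}"
  define q where "q = (\<lambda>(s, t). if s = t then g' t else (g t - g s) /\<^sub>R (t - s))"
  define r where "r = (\<lambda>(s, t). if s = t then \<i> * cis t else (cis t - cis s) /\<^sub>R (t - s))"
  have S: "open S" unfolding S_def by (intro open_Collect_less continuous_intros)
  have q: "continuous_on UNIV q"
    unfolding q_def by (rule continuous_on_difference_quotient[OF deriv_g cont_deriv])
  have r: "continuous_on UNIV r"
    unfolding r_def
  proof (rule continuous_on_difference_quotient)
    show "(cis has_vector_derivative \<i> * cis t) (at t)" for t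
      by (rule has_vector_derivative_cis)
    show "continuous_on UNIV (\<lambda>t. \<i> * cis t)" by (intro continuous_intros)
  qed
  have "continuous_on S (\<lambda>(s, t). chord_ratio s t)"
  proof (rule continuous_on_eq)
    have "r x \<noteq> 0" if "x \<in> S" for x
    proof -
      obtain s t where x: "x = (s, t)" by fastforce
      show ?thesis using that cis_eq_imp_eq[of s t] by (auto simp: x r_def S_def)
    qed
    then show "continuous_on S (\<lambda>x. q x / r x)"
      by (intro continuous_intros continuous_on_subset[OF q] continuous_on_subset[OF r]) auto
    show "q x / r x = (case x of (s, t) \<Rightarrow> chord_ratio s t)" if "x \<in> S" for x
    proof -
      obtain s t where x: "x = (s, t)" by fastforce
      show ?thesis using that cis_eq_imp_eq[of s t]
        by (auto simp: x q_def r_def S_def chord_ratio_def scaleR_conv_of_real divide_simps)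
    qed
  qed
  then show ?thesis
    unfolding continuous_on_eq_continuous_at[OF S] using assms by (auto simp only: S_def mem_Collect_eq)
qed

text \<open>Periodicity in \<open>t\<close> extends the previous strip. The larger one contains
  \<open>t - s = 2 * pi\<close>, the corner through which the diagonal is later deformed.\<close>

lemma continuous_on_chord_ratio:
  "continuous_on {(s, t). - 2 * pi < t - s \<and> t - s < 4 * pi} (\<lambda>(s, t). chord_ratio s t)"
proof (intro continuous_at_imp_continuous_on ballI)
  fix p assume p: "p \<in> {(s, t). - 2 * pi < t - s \<and> t - s < 4 * pi}"
  show "isCont (\<lambda>(s, t). chord_ratio s t) p"
  proof (cases "snd p - fst p < 2 * pi")
    case True
    then show ?thesis using p by (intro isCont_chord_ratio_aux) auto
  next
    case False
    have "isCont (\<lambda>(s, t). chord_ratio s t) (fst p, snd p - 2 * pi)"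
      using p False by (intro isCont_chord_ratio_aux) auto
    then have "isCont (\<lambda>x. (\<lambda>(s, t). chord_ratio s t) (fst x, snd x - 2 * pi)) p"
      by (rule isCont_o2[where f = "\<lambda>x. (fst x, snd x - 2 * pi)" and a = p, rotated])
        (intro continuous_intros)
    moreover have "chord_ratio s (t - 2 * pi) = chord_ratio s t" for s t
      by (rule chord_ratio_periodic) (simp flip: cis_divide)
    ultimately show ?thesis by (simp add: case_prod_unfold)
  qed
qed

end

text \<open>\<open>n\<close> is an outer normal of a supporting line at \<open>g s0\<close>, and
  \<open>c > 0\<close> says that the tangent there is \<open>n\<close> turned counterclockwise by a
  right angle, as on the circle.\<close>

locale supported_jordan_loop = smooth_jordan_loop +
  fixes s0 c :: real and n :: complex
  assumes n: "n \<noteq> 0" and support: "\<And>t. Re (cnj n * (g t - g s0)) \<le> 0"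
    and tangent: "g' s0 = of_real c * (\<i> * n)" and c: "c > 0"
begin

text \<open>A chord from \<open>g s0\<close> has no positive component along \<open>n\<close>, while
  \<open>cis (t - s0) - 1\<close> has negative real part off the diagonal. A negative factor
  \<open>k\<close> between the two would contradict the support inequality; on the diagonal the
  value is \<open>c\<close>.\<close>

lemma chord_ratio_slit: "chord_ratio s0 t * cis s0 / n \<notin> \<real>\<^sub>\<le>\<^sub>0"
proof (cases "cis s0 = cis t")
  case True
  have "g' t = of_real c * (\<i> * n)"
    using tangent deriv_periodic[OF True] by simp
  then have "chord_ratio s0 t * cis s0 / n = of_real c"
    using n True by (simp add: chord_ratio_def)
  then show ?thesis using c by simp
next
  case False
  show ?thesis
  proof
    assume "chord_ratio s0 t * cis s0 / n \<in> \<real>\<^sub>\<le>\<^sub>0"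
    then obtain k where k: "k \<le> 0" "chord_ratio s0 t * cis s0 / n = of_real k"
      by (auto simp: nonpos_Reals_def)
    then have "chord_ratio s0 t = of_real k * n / cis s0" using n by (simp add: field_simps)
    then have eq: "g t - g s0 = of_real k * n * (cis (t - s0) - 1)"
      unfolding chord_ratio_mult[of s0 t, symmetric] by (simp add: field_simps flip: cis_divide)
    have "k \<noteq> 0"
    proof
      assume "k = 0"
      then have "chord_ratio s0 t * cis s0 / n = 0" using k(2) by (simp only: of_real_0)
      then show False using chord_ratio_nonzero[of s0 t] n by simp
    qed
    have "Re (cnj n * (g t - g s0)) = (k * (norm n)\<^sup>2) * (cos (t - s0) - 1)"
      unfolding eq cmod_power2 by (simp add: power2_eq_square algebra_simps)
    moreover have "cos (t - s0) \<noteq> 1"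
    proof
      assume "cos (t - s0) = 1"
      then have "cis (t - s0) = 1"
        by (metis cis.code cos_one_sin_zero one_complex.code)
      then show False using False by (simp flip: cis_divide)
    qed
    then have "cos (t - s0) - 1 < 0" using cos_le_one[of "t - s0"] by linarith
    moreover have "k * (norm n)\<^sup>2 < 0" using k(1) \<open>k \<noteq> 0\<close> n by (simp add: mult_neg_pos)
    ultimately have "Re (cnj n * (g t - g s0)) > 0" by (simp add: mult_neg_neg)
    then show False using support[of t] by linarith
  qed
qed

text \<open>Hopf's homotopy: on the square \<open>[s0, s0 + 2 \<pi>]\<^sup>2\<close> the diagonal is deformed into the two legs through
  the corner \<open>(s0, s0 + 2 \<pi>)\<close>, on which one endpoint of each chord is the support point, so that
  the values stay in a slit plane.\<close>

theorem turning_number: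
  "winding_number (\<lambda>t. g' (s0 + 2 * pi * t) / (\<i> * cis (s0 + 2 * pi * t))) 0 = 0"
proof -
  \<comment> \<open>The triangle above the diagonal is convex, so the linear homotopy from
    \<open>P\<close> to \<open>L\<close> stays inside. \<open>L\<close> first raises the second
    coordinate by \<open>2 * pi\<close> and then the first.\<close>
  define T where "T = {(s, t). s0 \<le> s \<and> s \<le> t \<and> t \<le> s0 + 2 * pi}"
  define P where "P t = (s0 + 2 * pi * t, s0 + 2 * pi * t)" for t :: real
  define L where "L t = (s0 + 2 * pi * max 0 (2 * t - 1), s0 + 2 * pi * min 1 (2 * t))" for t :: real
  have T: "convex T"
  proof -
    have "T = {x. (1, 0) \<bullet> x \<ge> s0} \<inter> {x. (-1, 1) \<bullet> x \<ge> 0} \<inter> {x. (0, 1) \<bullet> x \<le> s0 + 2 * pi}"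
      by (auto simp: T_def)
    then show ?thesis by (simp add: convex_Int convex_halfspace_le convex_halfspace_ge)
  qed
  have hom: "homotopic_paths T P L"
  proof (rule homotopic_paths_linear)
    show "path P" "path L"
      unfolding path_def P_def L_def by (intro continuous_intros)+
    show "closed_segment (P t) (L t) \<subseteq> T" if t: "t \<in> {0..1}" for t
    proof (rule closed_segment_subset[OF _ _ T])
      have "2 * pi * t \<le> 2 * pi * 1" "2 * pi * t \<ge> 0" using t by (intro mult_left_mono mult_nonneg_nonneg; simp)+
      then show "P t \<in> T" by (simp add: P_def T_def)
      have "2 * pi * max 0 (2 * t - 1) \<le> 2 * pi * min 1 (2 * t)"
        "2 * pi * min 1 (2 * t) \<le> 2 * pi * 1" "0 \<le> 2 * pi * max 0 (2 * t - 1)"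
        using t by (intro mult_left_mono mult_nonneg_nonneg; auto)+
      then show "L t \<in> T" by (simp add: L_def T_def)
    qed
  qed (auto simp: P_def L_def pathstart_def pathfinish_def)
  let ?Q = "\<lambda>(s, t). chord_ratio s t"
  have contQ: "continuous_on T ?Q"
    by (rule continuous_on_subset[OF continuous_on_chord_ratio])
      (use pi_gt_zero in \<open>auto simp: T_def simp del: pi_gt_zero\<close>)
  have homQ: "homotopic_paths (- {0}) (?Q \<circ> P) (?Q \<circ> L)"
    by (rule homotopic_paths_continuous_image[OF hom contQ]) (auto simp: chord_ratio_nonzero)
  then have "winding_number (?Q \<circ> P) 0 = winding_number (?Q \<circ> L) 0"
    by (rule winding_number_homotopic_paths)
  \<comment> \<open>Divided by \<open>n / cis s0\<close>, the values along \<open>L\<close> avoid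
    the nonpositive axis, so this loop contracts linearly to a constant.\<close>
  also have "\<dots> = winding_number (linepath (n / cis s0) (n / cis s0)) 0"
  proof (rule winding_number_loops_linear_eq)
    show "path (?Q \<circ> L)" using homotopic_paths_imp_path[OF homQ] by blast
    have "chord_ratio (s0 + 2 * pi) (s0 + 2 * pi) = chord_ratio s0 s0"
      by (simp add: chord_ratio_def deriv_periodic[of "s0 + 2 * pi" s0] flip: cis_mult)
    then show "pathfinish (?Q \<circ> L) = pathstart (?Q \<circ> L)"
      by (simp add: pathfinish_def pathstart_def L_def)
    show "0 \<notin> closed_segment (linepath (n / cis s0) (n / cis s0) t) ((?Q \<circ> L) t)" if t: "t \<in> {0..1}" for t
    proof
      assume "0 \<in> closed_segment (linepath (n / cis s0) (n / cis s0) t) ((?Q \<circ> L) t)"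
      then have q: "(?Q \<circ> L) t * cis s0 / n \<in> \<real>\<^sub>\<le>\<^sub>0"
        using zero_in_closed_segment_imp_quotient_nonpos[of "n / cis s0" "(?Q \<circ> L) t"] n
        by (simp add: linepath_refl)
      have "\<exists>x. (?Q \<circ> L) t = chord_ratio s0 x"
      proof (cases "2 * t \<le> 1")
        case True
        then show ?thesis by (auto simp: L_def max_def)
      next
        case False
        then have "(?Q \<circ> L) t = chord_ratio (s0 + 2 * pi * (2 * t - 1)) (s0 + 2 * pi)"
          by (simp add: L_def)
        \<comment> \<open>On the second leg the endpoint \<open>s0 + 2 * pi\<close> is again the
          support point; periodicity, and then symmetry, turn the chord into one based at
          \<open>s0\<close>.\<close>
        also have "\<dots> = chord_ratio (s0 + 2 * pi * (2 * t - 1)) s0"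
          by (rule chord_ratio_periodic) (simp flip: cis_mult)
        finally show ?thesis unfolding chord_ratio_commute[of _ s0] by blast
      qed
      then show False using q chord_ratio_slit by auto
    qed
  qed auto
  also have "\<dots> = 0" by (rule winding_number_trivial) (use n in simp)
  finally show ?thesis by (simp add: P_def chord_ratio_def o_def)
qed

end

section \<open>Orientation at a support point: winding around a nearby inner point\<close>

context supported_jordan_loop
begin

lemma continuous_on_chord_ratio_base:
  "continuous_on {s0 - pi..s0 + pi} (chord_ratio s0)"
proof -
  have "continuous_on {s0 - pi..s0 + pi} (\<lambda>t. (\<lambda>(s, t). chord_ratio s t) (s0, t))"
    by (rule continuous_on_compose2[OF continuous_on_chord_ratio])
      (use pi_gt_zero in \<open>auto intro!: continuous_intros simp del: pi_gt_zero\<close>)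
  then show ?thesis by simp
qed

text \<open>With \<open>u = 0\<close> this is the unit circle and with \<open>u = 1\<close> the curve \<open>g\<close> (divided by \<open>cis s0\<close> and \<open>n\<close>), both
  seen from a point at distance \<open>e\<close> inside the base point: no member of the linear homotopy passes
  through that point.\<close>

lemma displaced_segment_nonzero:
  obtains e where "0 < e" "e \<le> 1"
    "\<And>u t. u \<in> {0..1} \<Longrightarrow>
      (cis (t - s0) - 1) * (of_real (1 - u) + of_real u * (chord_ratio s0 t * cis s0 / n)) + of_real e \<noteq> 0"
proof -
  define R where "R t = chord_ratio s0 t * cis s0 / n" for t
  define F where "F = (\<lambda>(u, t). (cis (t - s0) - 1) * (of_real (1 - u) + of_real u * R t))"
  have R: "continuous_on {s0 - pi..s0 + pi} R"
    unfolding R_def by (intro continuous_intros continuous_on_chord_ratio_base) (use n in auto)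
  have "isCont R s0"
    by (rule continuous_on_interior[OF R]) (simp add: interior_atLeastAtMost_real)
  moreover have "R s0 = of_real c"
    using n by (simp add: R_def chord_ratio_def tangent)
  moreover have "c / 2 > 0" using c by simp
  ultimately obtain d where d: "d > 0" "\<And>t. dist t s0 < d \<Longrightarrow> dist (R t) (of_real c) < c / 2"
    unfolding continuous_at_eps_delta by metis
  have "continuous_on UNIV (\<lambda>t. cis (t - s0))" by (intro continuous_intros)
  then have "isCont (\<lambda>t. cis (t - s0)) s0" by (simp add: continuous_on_eq_continuous_at)
  then obtain d' where d': "d' > 0" "\<And>t. dist t s0 < d' \<Longrightarrow> dist (cis (t - s0)) 1 < 1"
    unfolding continuous_at_eps_delta using zero_less_one by (metis cis_zero diff_self)
  define \<delta> where "\<delta> = min d d'"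
  have \<delta>: "\<delta> > 0" using d d' by (simp add: \<delta>_def)
  \<comment> \<open>Away from the base point compactness bounds the modulus of \<open>F\<close>
    below by some \<open>\<kappa> > 0\<close>. Near the base point \<open>F\<close> tends to 0 and a
    direct argument is needed.\<close>
  define C where "C = {0..1::real} \<times> {t. \<delta> \<le> \<bar>t - s0\<bar> \<and> \<bar>t - s0\<bar> \<le> pi}"
  have "{t. \<delta> \<le> \<bar>t - s0\<bar> \<and> \<bar>t - s0\<bar> \<le> pi} = {s0 - pi..s0 + pi} - {s0 - \<delta> <..< s0 + \<delta>}"
    by auto
  then have compC: "compact C"
    unfolding C_def by (auto intro!: compact_Times compact_diff)
  have nz: "F p \<noteq> 0" if p: "p \<in> C" for p
  proof -
    obtain u t where ut: "p = (u, t)" "u \<in> {0..1}" "\<delta> \<le> \<bar>t - s0\<bar>" "\<bar>t - s0\<bar> \<le> pi"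
      using p by (auto simp: C_def)
    have "cis (t - s0) - 1 \<noteq> 0"
    proof
      assume "cis (t - s0) - 1 = 0"
      then have "cis (t - s0) = cis 0" by simp
      then have "t - s0 = 0" by (rule cis_eq_imp_eq) (use ut pi_gt_zero in linarith)
      then show False using ut \<delta> by simp
    qed
    moreover have "of_real (1 - u) + of_real u * R t \<noteq> 0"
    proof
      assume "of_real (1 - u) + of_real u * R t = 0"
      then have "0 \<in> closed_segment 1 (R t)"
        using ut(2) by (auto simp: in_segment scaleR_conv_of_real intro!: exI[of _ u])
      then show False
        using zero_in_closed_segment_imp_quotient_nonpos[of 1 "R t"] chord_ratio_slit[of t] by (simp add: R_def)
    qed
    ultimately show ?thesis by (simp add: F_def ut(1))
  qed
  have contF: "continuous_on C F"
    unfolding F_def case_prod_unfold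
    by (intro continuous_intros continuous_on_compose2[OF R]) (auto simp: C_def abs_le_iff)
  obtain \<kappa> where \<kappa>: "\<kappa> > 0" "\<And>p. p \<in> C \<Longrightarrow> \<kappa> \<le> norm (F p)"
  proof (cases "C = {}")
    case True
    then show ?thesis using that[of 1] by auto
  next
    case False
    then obtain p where "p \<in> C" "\<And>q. q \<in> C \<Longrightarrow> norm (F p) \<le> norm (F q)"
      using continuous_attains_inf[OF compC False continuous_on_norm[OF contF]] by blast
    then show ?thesis using that[of "norm (F p)"] nz[of p] by simp
  qed
  \<comment> \<open>Half of \<open>\<kappa>\<close> makes \<open>e\<close> strictly smaller than the
    lower bound; the cap 1 will put the comparison point inside the unit disc.\<close>
  define e where "e = min (\<kappa> / 2) 1"
  have e: "0 < e" "e \<le> 1" "e < \<kappa>" using \<kappa>(1) by (auto simp: e_def)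
  have local: "F (u, t) + of_real e \<noteq> 0" if u: "u \<in> {0..1}" and t: "\<bar>t - s0\<bar> \<le> pi" for u t
  proof (cases "\<delta> \<le> \<bar>t - s0\<bar>")
    case True
    then have "(u, t) \<in> C" using u t by (simp add: C_def)
    then have "e < norm (F (u, t))" using \<kappa>(2) e(3) by fastforce
    then show ?thesis using e(1) by (auto simp: add_eq_0_iff2)
  next
    case False
    then have t': "dist t s0 < d" "dist t s0 < d'" by (auto simp: \<delta>_def dist_real_def)
    define D where "D = cis (t - s0) - 1"
    define K where "K = of_real (1 - u) + of_real u * R t"
    have "norm (R t - of_real c) < c / 2" using d(2)[OF t'(1)] by (simp add: dist_norm)
    then have "\<bar>Re (R t) - c\<bar> < c / 2" "\<bar>Im (R t)\<bar> < c / 2"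
      using abs_Re_le_cmod[of "R t - of_real c"] abs_Im_le_cmod[of "R t - of_real c"] by auto
    \<comment> \<open>Near the base point \<open>R t\<close> lies in the sector of opening angle
      \<open>pi / 2\<close> around the positive axis. The sector is convex and contains 1, hence
      also contains \<open>K\<close>.\<close>
    then have RI: "\<bar>Im (R t)\<bar> \<le> Re (R t)" "Re (R t) \<ge> 0" using c by linarith+
    have "\<bar>Im K\<bar> = u * \<bar>Im (R t)\<bar>" using u by (simp add: K_def abs_mult)
    also have "\<dots> \<le> u * Re (R t)" using RI u by (intro mult_left_mono) auto
    also have "\<dots> \<le> Re K" using u by (simp add: K_def)
    finally have KI: "\<bar>Im K\<bar> \<le> Re K" .
    have normK: "norm K \<le> 2 * Re K" using cmod_le[of K] KI by linarith
    have D1: "norm D < 1" using d'(2)[OF t'(2)] by (simp add: D_def dist_norm)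
    \<comment> \<open>This holds because \<open>1 + D\<close> is unimodular. If
      \<open>D * K = - e\<close>, moduli and real parts together give \<open>e = 2 * Re K\<close>,
      whereas \<open>norm D < 1\<close> gives \<open>e < norm K \<le> 2 * Re K\<close>.\<close>
    have ReD: "Re D = - (norm D)\<^sup>2 / 2"
      unfolding cmod_power2 D_def using sin_cos_squared_add[of "t - s0"]
      by (simp add: power2_eq_square algebra_simps)
    show ?thesis
    proof
      assume "F (u, t) + of_real e = 0"
      then have DK: "D * K = - of_real e" by (simp add: F_def D_def K_def add_eq_0_iff2)
      then have "D * (of_real ((norm K)\<^sup>2)) = - of_real e * cnj K"
        by (metis complex_norm_square mult.assoc)
      then have "Re (D * (of_real ((norm K)\<^sup>2))) = Re (- of_real e * cnj K)" by simp
      then have 1: "Re D * (norm K)\<^sup>2 = - e * Re K" by simp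
      have nDK: "norm D * norm K = e" using arg_cong[OF DK, of norm] e by (simp add: norm_mult)
      then have 2: "(norm D)\<^sup>2 * (norm K)\<^sup>2 = e\<^sup>2" by (simp flip: power_mult_distrib)
      have "- ((norm D)\<^sup>2 * (norm K)\<^sup>2) = 2 * (- e * Re K)" using 1 unfolding ReD by simp
      then have "e * e = e * (2 * Re K)" unfolding 2 by (simp add: power2_eq_square algebra_simps)
      then have eK: "e = 2 * Re K" using e(1) by (metis less_irrefl mult_left_cancel)
      have "norm K > 0" using nDK e(1) by (metis mult_zero_right norm_ge_zero order_le_less order_less_irrefl)
      then have "norm D * norm K < 1 * norm K" using D1 by (intro mult_strict_right_mono)
      then show False using nDK eK normK by linarith
    qed
  qed
  show thesis
  proof
    fix u t :: real assume u: "u \<in> {0..1}"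
    \<comment> \<open>The representative of \<open>t\<close> modulo \<open>2 * pi\<close> in the
      window of half-width \<open>pi\<close> around \<open>s0\<close>, where the bound was
      proved.\<close>
    define t' where "t' = s0 + Arg (cis (t - s0))"
    have "cis (t' - s0) = cis (t - s0)" by (simp add: t'_def cis_Arg sgn_div_norm)
    moreover then have "cis t' = cis t" by (simp flip: cis_divide)
    then have "chord_ratio s0 t' = chord_ratio s0 t" by (rule chord_ratio_periodic)
    moreover have "\<bar>t' - s0\<bar> \<le> pi"
      using Arg_bounded[of "cis (t - s0)"] by (simp add: t'_def abs_le_iff)
    ultimately show "(cis (t - s0) - 1) * (of_real (1 - u) + of_real u * (chord_ratio s0 t * cis s0 / n)) + of_real e \<noteq> 0"
      using local[OF u, of t'] by (simp add: F_def R_def)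
  qed (use e in auto)
qed

theorem winding_number_inner_point:
  obtains e where "e > 0" "winding_number (\<lambda>t. g (2 * pi * t)) (g s0 - of_real e * n) = 1"
    "g s0 - of_real e * n \<notin> path_image (\<lambda>t. g (2 * pi * t))"
proof -
  obtain e where e: "0 < e" "e \<le> 1" and nz: "\<And>u t. u \<in> {0..1} \<Longrightarrow>
      (cis (t - s0) - 1) * (of_real (1 - u) + of_real u * (chord_ratio s0 t * cis s0 / n)) + of_real e \<noteq> 0"
    using displaced_segment_nonzero by blast
  define z where "z = g s0 - of_real e * n"
  \<comment> \<open>The point of the unit disc at depth \<open>e\<close> below
    \<open>cis s0\<close>. The factor \<open>n / cis s0\<close> in \<open>?h\<close> turns the
    normal of the circle at \<open>cis s0\<close> into \<open>n\<close>, so that \<open>?h\<close>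
    and \<open>?p\<close> see their displaced points from matching positions.\<close>
  define w where "w = of_real (1 - e) * cis s0"
  let ?\<gamma> = "\<lambda>t. circlepath 0 1 t - w"
  let ?h = "\<lambda>t. n / cis s0 * ?\<gamma> t"
  let ?p = "\<lambda>t. g (2 * pi * t) - z"
  have circ: "circlepath 0 1 t = cis (2 * pi * t)" for t
    by (simp add: circlepath cis_conv_exp mult_ac)
  have "norm w = \<bar>1 - e\<bar>" unfolding w_def norm_mult norm_of_real by simp
  then have norm_w: "norm w < 1" using e by simp
  have w: "w \<notin> sphere 0 1" using norm_w by simp
  have h: "?h t = n * (cis (2 * pi * t - s0) - 1 + of_real e)" for t
    by (simp add: circ w_def field_simps flip: cis_divide)
  have p: "?p t = n * ((cis (2 * pi * t - s0) - 1) * (chord_ratio s0 (2 * pi * t) * cis s0 / n) + of_real e)" for t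
  proof -
    have eq: "?p t = chord_ratio s0 (2 * pi * t) * (cis (2 * pi * t) - cis s0) + of_real e * n"
      unfolding chord_ratio_mult by (simp add: z_def)
    show ?thesis unfolding eq using n by (simp add: field_simps flip: cis_divide)
  qed
  have seg: "0 \<notin> closed_segment (?h t) (?p t)" for t
  proof
    assume "0 \<in> closed_segment (?h t) (?p t)"
    then obtain u where u: "u \<in> {0..1}" "(1 - u) *\<^sub>R ?h t + u *\<^sub>R ?p t = 0"
      unfolding in_segment by force
    have "(1 - u) *\<^sub>R ?h t + u *\<^sub>R ?p t = n * ((cis (2 * pi * t - s0) - 1) *
        (of_real (1 - u) + of_real u * (chord_ratio s0 (2 * pi * t) * cis s0 / n)) + of_real e)"
      unfolding h p by (simp add: scaleR_conv_of_real algebra_simps)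
    then show False using u(2) n nz[OF u(1), of "2 * pi * t"] by (metis mult_eq_0_iff)
  qed
  have contp: "path ?p"
    unfolding path_def by (intro continuous_intros continuous_on_compose2[OF cont_g]) auto
  have conth: "path ?\<gamma>"
    using path_circlepath[of 0 1] unfolding path_def by (intro continuous_intros)
  have "winding_number ?p 0 = winding_number ?h 0"
  proof (rule winding_number_loops_linear_eq)
    show "path ?h"
      unfolding path_def by (rule continuous_on_mult_left[OF conth[unfolded path_def]])
    show "pathfinish ?p = pathstart ?p"
      using g_eq_iff[of "2 * pi" 0] by (simp add: pathfinish_def pathstart_def)
    show "0 \<notin> closed_segment (?h t) (?p t)" for t by (rule seg)
  qed (use contp in \<open>auto simp: pathfinish_def pathstart_def circ\<close>)
  also have "\<dots> = winding_number ?\<gamma> 0"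
  proof (rule winding_number_mult_left[OF conth])
    show "0 \<notin> path_image ?\<gamma>"
    proof
      assume "0 \<in> path_image ?\<gamma>"
      then have "w \<in> path_image (circlepath 0 1)" by (auto simp: path_image_def)
      then show False using w by simp
    qed
  qed (use n in \<open>auto simp: pathfinish_def pathstart_def circ\<close>)
  also have "\<dots> = winding_number (circlepath 0 1) w" by (rule winding_number_offset[symmetric])
  also have "\<dots> = 1" by (rule winding_number_circlepath) (use norm_w in simp)
  finally have 1: "winding_number (\<lambda>t. g (2 * pi * t)) z = 1"
    by (subst winding_number_offset)
  have "z \<notin> path_image (\<lambda>t. g (2 * pi * t))"
  proof
    assume "z \<in> path_image (\<lambda>t. g (2 * pi * t))"
    then obtain t where "z = g (2 * pi * t)" by (auto simp: path_image_def)
    then have "?p t = 0" by simp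
    then show False using seg[of t] by (metis ends_in_segment(2))
  qed
  then show thesis using that[OF e(1)] 1 by (simp add: z_def)
qed

end

text \<open>By the argument principle the winding number is the sum of the zero orders, all of them
  positive. Since \<open>f\<close> is merely continuous on the unit circle, the zeros are counted on
  a smaller circle that still encloses them, and the two image loops are homotopic through a
  zero-free annulus.\<close>

lemma holomorphic_zero_free_if_winding_number_zero:
  assumes hol: "f holomorphic_on ball 0 1" and cont: "continuous_on (cball 0 1) f"
    and nz: "\<And>z. z \<in> sphere 0 1 \<Longrightarrow> f z \<noteq> 0"
    and wn: "winding_number (f \<circ> circlepath 0 1) 0 = 0"
    and z: "z \<in> cball 0 1"
  shows "f z \<noteq> 0"
proof -
  define Z where "Z = {z \<in> cball 0 1. f z = 0}"
  have "compact Z"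
  proof -
    have "closed (cball 0 1 \<inter> f -` {0})"
      by (rule continuous_closed_preimage[OF cont]) auto
    moreover have "Z = cball 0 1 \<inter> (cball 0 1 \<inter> f -` {0})" by (auto simp: Z_def)
    ultimately show ?thesis by (metis compact_Int_closed compact_cball)
  qed
  obtain r where r: "0 < r" "r < 1" "\<And>z. z \<in> Z \<Longrightarrow> norm z < r"
  proof (cases "Z = {}")
    case True
    then show ?thesis using that[of "1/2"] by auto
  next
    case False
    then obtain x where x: "x \<in> Z" "\<And>y. y \<in> Z \<Longrightarrow> norm y \<le> norm x"
      using continuous_attains_sup[OF \<open>compact Z\<close> False, of norm] continuous_on_norm_id by blast
    have "norm x < 1" using x(1) nz[of x] by (force simp: Z_def order_le_less)
    show ?thesis
    proof (rule that)
      show "0 < (norm x + 1) / 2" by (simp add: add_nonneg_pos)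
      show "(norm x + 1) / 2 < 1" using \<open>norm x < 1\<close> by simp
      show "norm y < (norm x + 1) / 2" if "y \<in> Z" for y using x(2)[OF that] \<open>norm x < 1\<close> by simp
    qed
  qed
  define A where "A = {z :: complex. r \<le> norm z \<and> norm z \<le> 1}"
  have "homotopic_loops A (circlepath 0 r) (circlepath 0 1)"
  proof (rule homotopic_loops_linear)
    show "closed_segment (circlepath 0 r t) (circlepath 0 1 t) \<subseteq> A" for t
    proof
      fix x assume "x \<in> closed_segment (circlepath 0 r t) (circlepath 0 1 t)"
      then obtain u where u: "0 \<le> u" "u \<le> 1" "x = (1 - u) *\<^sub>R circlepath 0 r t + u *\<^sub>R circlepath 0 1 t"
        unfolding in_segment by blast
      have "x = of_real ((1 - u) * r + u) * exp (2 * of_real pi * \<i> * of_real t)"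
        unfolding u(3) by (simp add: circlepath scaleR_conv_of_real algebra_simps)
      then have "norm x = \<bar>(1 - u) * r + u\<bar>"
        by (simp only: norm_mult norm_of_real) simp
      moreover have "0 \<le> (1 - u) * r + u" using u r by simp
      moreover have "(1 - u) * r \<le> (1 - u) * 1" using u r by (intro mult_left_mono) auto
      moreover have "u * r \<le> u * 1" using u r by (intro mult_left_mono) auto
      ultimately show "x \<in> A" by (simp add: A_def algebra_simps)
    qed
  qed auto
  moreover have "continuous_on A f" by (rule continuous_on_subset[OF cont]) (auto simp: A_def)
  moreover have fA: "f \<in> A \<rightarrow> - {0}"
  proof
    fix x assume "x \<in> A"
    then have "x \<in> cball 0 1" "\<not> norm x < r" by (auto simp: A_def)
    then show "f x \<in> - {0}" using r(3)[of x] by (auto simp: Z_def)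
  qed
  ultimately have "homotopic_loops (- {0}) (f \<circ> circlepath 0 r) (f \<circ> circlepath 0 1)"
    by (rule homotopic_loops_continuous_image)
  then have w0: "winding_number (f \<circ> circlepath 0 r) 0 = 0"
    using winding_number_homotopic_loops wn by metis
  have img: "path_image (circlepath 0 r) = sphere 0 r" using r by simp
  have sub: "sphere 0 r \<subseteq> ball (0::complex) 1" using r by auto
  have sA: "sphere 0 r \<subseteq> A" using r by (auto simp: A_def)
  \<comment> \<open>The disjunct \<open>w \<in> {}\<close> stands for an empty set of poles and
    matches the shape of \<open>argument_principle\<close>, which is applied with weight function
    1.\<close>
  define pz where "pz = {w \<in> ball 0 1. f w = 0 \<or> w \<in> {}}"
  have pzZ: "pz \<subseteq> Z" by (auto simp: pz_def Z_def)
  have nzr: "f (of_real r) \<noteq> 0" using fA r by (auto simp: A_def Pi_def)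
  \<comment> \<open>Discreteness of the zeros needs a nonconstant function; a constant one has no
    zeros by its nonzero value at \<open>r\<close>.\<close>
  have fin: "finite pz"
  proof (cases "f constant_on ball 0 1")
    case True
    then obtain k where k: "\<And>x. x \<in> ball 0 1 \<Longrightarrow> f x = k" by (auto simp: constant_on_def)
    then have "k \<noteq> 0" using nzr r k[of "of_real r"] by simp
    then have "pz = {}" using k by (auto simp: pz_def)
    then show ?thesis by simp
  next
    case False
    have "finite {z \<in> cball 0 r. f z = 0}"
      by (rule holomorphic_compact_finite_zeros[OF hol _ _ _ _ False]) (use r in auto)
    moreover have "pz \<subseteq> {z \<in> cball 0 r. f z = 0}" using r(3) pzZ by (fastforce simp: Z_def)
    ultimately show ?thesis by (rule finite_subset[rotated])
  qed
  have ap: "contour_integral (circlepath 0 r) (\<lambda>x. deriv f x * 1 / f x) = 2 * pi * \<i> *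
          (\<Sum>p\<in>pz. winding_number (circlepath 0 r) p * 1 * zorder f p)"
    unfolding pz_def
  proof (rule argument_principle)
    show "path_image (circlepath 0 r) \<subseteq> ball 0 1 - {w \<in> ball 0 1. f w = 0 \<or> w \<in> {}}"
      unfolding img using sub sA fA by (auto simp: Pi_def)
    show "\<forall>z. z \<notin> ball 0 1 \<longrightarrow> winding_number (circlepath 0 r) z = 0"
    proof (intro allI impI)
      fix z :: complex assume "z \<notin> ball 0 1"
      then have "z \<notin> cball 0 r" using r by auto
      then show "winding_number (circlepath 0 r) z = 0"
        by (intro winding_number_zero_outside[of _ "cball 0 r"]) (use r in auto)
    qed
  qed (use fin hol in \<open>auto simp: pz_def\<close>)
  have an: "f analytic_on ball 0 1" using hol by (simp add: analytic_on_open)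
  have vp: "valid_path (f \<circ> circlepath 0 r)"
    by (rule valid_path_compose_holomorphic[OF _ hol]) (use img sub in auto)
  have "0 \<notin> path_image (f \<circ> circlepath 0 r)"
    unfolding path_image_compose img using sA fA by (auto simp: Pi_def)
  then have "contour_integral (f \<circ> circlepath 0 r) (\<lambda>w. 1 / (w - 0)) = 0"
    using winding_number_valid_path[OF vp] w0 by simp
  moreover have "contour_integral (f \<circ> circlepath 0 r) (\<lambda>w. 1 / (w - 0))
      = contour_integral (circlepath 0 r) (\<lambda>w. deriv f w * (1 / (f w - 0)))"
    by (rule contour_integral_comp_analyticW[OF an]) (use img sub in auto)
  ultimately have "(\<Sum>p\<in>pz. winding_number (circlepath 0 r) p * 1 * zorder f p) = 0"
    using ap by simp
  moreover have "(\<Sum>p\<in>pz. winding_number (circlepath 0 r) p * 1 * zorder f p) = (\<Sum>p\<in>pz. of_int (zorder f p))"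
    by (rule sum.cong) (use r(3) pzZ in \<open>auto simp: winding_number_circlepath\<close>)
  ultimately have "(\<Sum>p\<in>pz. (of_int (zorder f p) :: complex)) = 0" by metis
  then have "of_int (\<Sum>p\<in>pz. zorder f p) = (0 :: complex)" by simp
  then have s0: "(\<Sum>p\<in>pz. zorder f p) = 0" by (simp only: of_int_eq_0_iff)
  have pos: "zorder f p > 0" if "p \<in> pz" for p
    using zorder_exist_zero[OF hol, of p] that nzr r by (force simp: pz_def)
  have "pz = {}"
    using sum_pos[OF fin _ pos] s0 by fastforce
  then show ?thesis using nz[of z] z by (force simp: pz_def order_le_less)
qed

section \<open>Jordan domains\<close>

text \<open>A side \<open>X\<close> of the curve that meets \<open>D\<close> misses the frontier of
  \<open>D\<close>, so it lies in \<open>D\<close>. Boundedness makes it the inside, and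
  connectedness of \<open>D\<close> then excludes the outside.\<close>

lemma Jordan_domain_eq_inside:
  fixes p :: "real \<Rightarrow> complex"
  assumes p: "simple_path p" "pathfinish p = pathstart p"
    and D: "open D" "connected D" "bounded D" "frontier D = path_image p"
  shows "D = inside (path_image p)"
proof -
  note J = Jordan_inside_outside[OF p]
  have "path_image p \<inter> D = {}" using D(1,4) frontier_disjoint_eq[of D] by simp
  then have D_sub: "D \<subseteq> inside (path_image p) \<union> outside (path_image p)" using J by blast
  have "D \<noteq> {}" using D(4) path_image_nonempty[of p] by auto
  then obtain d where "d \<in> D" by blast
  then have "d \<in> inside (path_image p) \<or> d \<in> outside (path_image p)" using D_sub by blast
  then obtain X where X: "X = inside (path_image p) \<or> X = outside (path_image p)" "X \<inter> D \<noteq> {}"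
    using \<open>d \<in> D\<close> by blast
  have Xo: "open X" "connected X" "X \<inter> path_image p = {}" using X(1) J by blast+
  have "X \<subseteq> D"
  proof (rule ccontr)
    assume "\<not> X \<subseteq> D"
    then have "X \<inter> frontier D \<noteq> {}" using X(2) by (intro connected_Int_frontier[OF Xo(2)]) auto
    then show False using Xo(3) D(4) by simp
  qed
  then have Xi: "X = inside (path_image p)" using X(1) J D(3) bounded_subset by blast
  have "outside (path_image p) \<inter> D = {}"
    using connectedD[OF D(2), of "inside (path_image p)" "outside (path_image p)"] J D_sub X(2) Xi by blast
  then show ?thesis using \<open>X \<subseteq> D\<close> Xi D_sub by blast
qed

text \<open>Segments from \<open>x\<close> to other points of the disc stay in the disc even when
  \<open>x\<close> is on the circle, and their directions determine a linear map.\<close>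

lemma has_derivative_unique_cball:
  fixes f :: "complex \<Rightarrow> complex"
  assumes f: "(f has_derivative f') (at x within cball 0 1)" "(f has_derivative f'') (at x within cball 0 1)"
    and x: "x \<in> cball 0 1"
  shows "f' = f''"
proof -
  interpret f': bounded_linear f' using f(1) by (rule has_derivative_bounded_linear)
  interpret f'': bounded_linear f'' using f(2) by (rule has_derivative_bounded_linear)
  have eq: "f' (y - x) = f'' (y - x)" if y: "y \<in> cball 0 1" for y
  proof -
    let ?p = "\<lambda>t :: real. x + t *\<^sub>R (y - x)"
    have p: "(?p has_vector_derivative (y - x)) (at 0 within cbox 0 1)"
      by (auto intro!: derivative_eq_intros)
    have "?p ` cbox 0 1 \<subseteq> cball 0 1"
    proof
      fix z assume "z \<in> ?p ` cbox 0 1"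
      then obtain t where "0 \<le> t" "t \<le> 1" "z = (1 - t) *\<^sub>R x + t *\<^sub>R y" by (auto simp: algebra_simps)
      then show "z \<in> cball 0 1" using convexD_alt[OF convex_cball x y] by simp
    qed
    then have sub: "(f has_derivative F) (at x within cball 0 1) \<Longrightarrow> (f has_derivative F) (at (?p 0) within ?p ` cbox 0 1)" for F
      by (simp add: has_derivative_subset)
    show ?thesis
      by (rule vector_derivative_unique_within_closed_interval[OF _ _
            vector_derivative_diff_chain_within[OF p sub[OF f(1)]]
            vector_derivative_diff_chain_within[OF p sub[OF f(2)]]]) auto
  qed
  show ?thesis
  proof
    fix h :: complex
    have "norm h + 1 > 0" by (simp add: add_nonneg_pos)
    then have "(1 / (norm h + 1)) *\<^sub>R h \<in> cball 0 1" "h = (norm h + 1) *\<^sub>R ((1 / (norm h + 1)) *\<^sub>R h)"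
      by auto
    then obtain r k where k: "k \<in> cball 0 1" "h = r *\<^sub>R k" by blast
    \<comment> \<open>\<open>k\<close> is the difference of two admissible directions, one towards
      \<open>k\<close> and one towards the centre.\<close>
    have "f' k = f' (k - x) - f' (0 - x)" using f'.diff[of "k - x" "0 - x"] by simp
    also have "\<dots> = f'' (k - x) - f'' (0 - x)" using eq[OF k(1)] eq[of 0] by simp
    also have "\<dots> = f'' k" using f''.diff[of "k - x" "0 - x"] by simp
    finally show "f' h = f'' h" by (simp add: k(2) f'.scaleR f''.scaleR)
  qed
qed

lemma range_cis: "range cis = sphere 0 1"
proof
  show "sphere 0 1 \<subseteq> range cis"
  proof
    fix z :: complex assume z: "z \<in> sphere 0 1"
    then have "z \<noteq> 0" by auto
    then have "cis (Arg z) = z" using z by (simp add: cis_Arg sgn_div_norm)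
    then show "z \<in> range cis" by (metis rangeI)
  qed
qed auto

locale jordan_domain_loop = smooth_jordan_loop +
  fixes D :: "complex set"
  assumes D: "open D" "connected D" "bounded D" "frontier D = range g"
    and winding: "\<And>z. z \<in> D \<Longrightarrow> winding_number (\<lambda>t. g (2 * pi * t)) z = 1"
begin

abbreviation loop :: "real \<Rightarrow> complex" where "loop \<equiv> \<lambda>t. g (2 * pi * t)"

lemma simple_path_loop: "simple_path loop"
  unfolding simple_path_def loop_free_def
proof (intro conjI ballI impI)
  show "path loop"
    unfolding path_def by (intro continuous_on_compose2[OF cont_g] continuous_intros) auto
  fix s t :: real assume s: "s \<in> {0..1}" and t: "t \<in> {0..1}" and eq: "loop s = loop t"
  show "s = t \<or> s = 0 \<and> t = 1 \<or> s = 1 \<and> t = 0"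
  proof (cases "\<bar>s - t\<bar> < 1")
    case True
    have "\<bar>2 * pi * s - 2 * pi * t\<bar> = 2 * pi * \<bar>s - t\<bar>"
      by (simp add: abs_mult flip: right_diff_distrib)
    also have "\<dots> < 2 * pi * 1" using True by (intro mult_strict_left_mono) auto
    finally have "2 * pi * s = 2 * pi * t" using eq g_eq_iff by (intro cis_eq_imp_eq) auto
    then show ?thesis by simp
  next
    case False
    then show ?thesis using s t by auto
  qed
qed

lemma loop_closed: "pathfinish loop = pathstart loop"
  using g_eq_iff[of "2 * pi" 0] by (simp add: pathfinish_def pathstart_def)

lemma path_image_loop: "path_image loop = range g"
proof
  show "range g \<subseteq> path_image loop"
  proof
    fix x assume "x \<in> range g"
    then obtain t where x: "x = g t" by blast
    define r where "r = Arg2pi (cis t) / (2 * pi)"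
    have r: "r \<in> {0..1}" using Arg2pi_ge_0[of "cis t"] Arg2pi_lt_2pi[of "cis t"] by (simp add: r_def)
    have "cis (2 * pi * r) = cis t"
      using Arg2pi_eq[of "cis t"] by (simp add: r_def cis_conv_exp)
    then have "loop r = x" using g_eq_iff x by blast
    then show "x \<in> path_image loop" using r by (auto simp: path_image_def)
  qed
qed (auto simp: path_image_def)

lemma D_disjoint_range: "D \<inter> range g = {}"
  using D(1,4) frontier_disjoint_eq[of D] by (simp add: Int_commute)

lemma D_eq_inside: "D = inside (range g)"
  using Jordan_domain_eq_inside[OF simple_path_loop loop_closed D(1-3)] D(4) path_image_loop by simp

lemmas Jordan = Jordan_inside_outside[OF simple_path_loop loop_closed, unfolded path_image_loop]

text \<open>If the tangent pointed the other way, the reversed loop would wind once around a point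
  just inside the supporting line, and the loop itself -1 times. That point is then not outside the
  curve, so it lies in \<open>D\<close>, where the winding number is 1.\<close>

lemma supported_tangent_pos:
  assumes n: "n \<noteq> 0" and support: "\<And>t. Re (cnj n * (g t - g s)) \<le> 0"
    and tangent: "g' s = of_real c * (\<i> * n)"
  shows "c > 0"
proof (rule ccontr)
  assume "\<not> c > 0"
  moreover have "c \<noteq> 0" using tangent regular[of s] by auto
  ultimately have c: "- c > 0" by simp
  interpret R: supported_jordan_loop "\<lambda>t. g (- t)" "\<lambda>t. - g' (- t)" "- s" "- c" n
  proof
    show "((\<lambda>t. g (- t)) has_vector_derivative - g' (- t)) (at t)" for t
    proof -
      have "((g \<circ> uminus) has_vector_derivative (- 1 *\<^sub>R g' (- t))) (at t)"
        by (intro vector_diff_chain_at deriv_g) (auto intro!: derivative_eq_intros)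
      then show ?thesis by (simp add: o_def)
    qed
    show "continuous_on UNIV (\<lambda>t. - g' (- t))"
      by (intro continuous_intros continuous_on_compose2[OF cont_deriv]) auto
    show "(g (- s) = g (- t)) = (cis s = cis t)" for s t
      unfolding g_eq_iff by (simp flip: cis_cnj)
  qed (use n support tangent c regular in auto)
  obtain e where e: "winding_number (\<lambda>t. g (- (2 * pi * t))) (g s - of_real e * n) = 1"
    "g s - of_real e * n \<notin> path_image (\<lambda>t. g (- (2 * pi * t)))"
    using R.winding_number_inner_point by auto
  define z where "z = g s - of_real e * n"
  have "reversepath loop = (\<lambda>t. g (- (2 * pi * t)))"
  proof
    show "reversepath loop t = g (- (2 * pi * t))" for t
      unfolding reversepath_def g_eq_iff by (simp add: right_diff_distrib divide_inverse flip: cis_divide)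
  qed
  then have 1: "winding_number (reversepath loop) z = 1" "z \<notin> path_image (reversepath loop)"
    using e by (simp_all add: z_def)
  then have zp: "z \<notin> path_image loop" by (simp only: path_image_reversepath not_False_eq_True)
  have w: "winding_number loop z = - 1"
    using winding_number_reversepath[OF _ zp] 1(1) simple_path_imp_path[OF simple_path_loop]
    by (metis add.inverse_inverse)
  have "z \<notin> outside (path_image loop)"
    using winding_number_zero_in_outside[OF simple_path_imp_path[OF simple_path_loop] loop_closed] w by fastforce
  then have "z \<in> D" using zp Jordan unfolding D_eq_inside path_image_loop by blast
  then show False using winding[of z] w by simp
qed

end

section \<open>Sign of the Jacobian determinant\<close>

lemma inj_derivative_lower_bound:
  "(norm a - norm b) * norm h \<le> norm (a * h + b * cnj h)" for a b h :: complex
  using norm_diff_ineq[of "a * h" "b * cnj h"] by (simp add: norm_mult algebra_simps)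

locale kneser_problem = harmonic_disc U a b + jordan_domain_loop g g' D
  for U a b g g' D +
  assumes boundary: "U (cis t) = g t"
begin

lemma tangent_eq: "g' t = \<i> * (a (cis t) * cis t - b (cis t) * cnj (cis t))"
proof -
  have "range cis \<subseteq> cball 0 1" by auto
  then have "(U has_derivative (\<lambda>h. a (cis t) * h + b (cis t) * cnj h)) (at (cis t) within range cis)"
    by (rule has_derivative_subset[OF der, rotated]) simp
  then have "((U \<circ> cis) has_vector_derivative (a (cis t) * (\<i> * cis t) + b (cis t) * cnj (\<i> * cis t))) (at t)"
    by (rule vector_derivative_diff_chain_within[OF has_vector_derivative_cis])
  moreover have "U \<circ> cis = g" by (auto simp: boundary)
  ultimately have "(g has_vector_derivative (\<i> * (a (cis t) * cis t - b (cis t) * cnj (cis t)))) (at t)"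
    by (simp add: algebra_simps)
  then show ?thesis by (rule vector_derivative_unique_at[OF deriv_g])
qed

lemma sphere_boundary:
  assumes "x \<in> sphere 0 1"
  obtains t where "x = cis t" "U x = g t"
  using assms boundary unfolding range_cis[symmetric] by blast

text \<open>Otherwise the curve would lie on a line; Rolle's theorem over one period gives a
  parameter at which the remaining component of \<open>g'\<close> vanishes as well, against
  regularity.\<close>

lemma component_not_constant:
  assumes n: "n \<noteq> 0"
  shows "\<exists>t. Re (cnj n * (g t - g s)) \<noteq> 0"
proof (rule ccontr)
  assume "\<nexists>t. Re (cnj n * (g t - g s)) \<noteq> 0"
  then have z: "(\<lambda>t. Re (cnj n * (g t - g s))) = (\<lambda>_. 0)" by auto
  have vd: "((\<lambda>t. cnj n * (g t - g s)) has_vector_derivative cnj n * g' t) (at t)" for t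
    by (auto intro!: derivative_eq_intros deriv_g)
  have Re0: "Re (cnj n * g' t) = 0" for t
  proof -
    have "((\<lambda>t. Re (cnj n * (g t - g s))) has_vector_derivative Re (cnj n * g' t)) (at t)"
      by (rule bounded_linear.has_vector_derivative[OF bounded_linear_Re vd])
    then show ?thesis unfolding z using vector_derivative_unique_at has_vector_derivative_const by blast
  qed
  have der_Im: "((\<lambda>t. Im (cnj n * (g t - g s))) has_derivative (\<lambda>h. h * Im (cnj n * g' t))) (at t)" for t
    using bounded_linear.has_vector_derivative[OF bounded_linear_Im vd, of t]
    by (simp add: has_vector_derivative_def)
  have "\<exists>t. 0 < t \<and> t < 2 * pi \<and> (\<lambda>h. h * Im (cnj n * g' t)) = (\<lambda>v. 0)"
  proof (rule Rolle_deriv[OF _ _ _ der_Im])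
    show "Im (cnj n * (g 0 - g s)) = Im (cnj n * (g (2 * pi) - g s))"
      using g_eq_iff[of 0 "2 * pi"] by simp
    show "continuous_on {0..2 * pi} (\<lambda>t. Im (cnj n * (g t - g s)))"
      by (intro continuous_intros continuous_on_subset[OF cont_g]) auto
  qed auto
  then obtain t where "(\<lambda>h :: real. h * Im (cnj n * g' t)) = (\<lambda>v. 0)" by blast
  then have "1 * Im (cnj n * g' t) = 0" by (rule fun_cong)
  then have "cnj n * g' t = 0" using Re0[of t] by (simp only: complex_eq_iff zero_complex.sel mult_1)
  then show False using n regular by simp
qed

text \<open>\<open>A + B\<close> and \<open>\<i> * (A - B)\<close> are the radial and the tangential
  derivative, and \<open>Re (cnj (A - B) * (A + B))\<close> is the determinant in this frame. With
  \<open>A - B = c * n\<close> it becomes \<open>c\<close> times the normal component given by the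
  Hopf lemma.\<close>

lemma det_pos_at_support:
  assumes n: "n \<noteq> 0" and support: "\<And>t. Re (cnj n * (g t - g s)) \<le> 0"
  shows "norm (b (cis s)) < norm (a (cis s))"
proof -
  define A where "A = a (cis s) * cis s"
  define B where "B = b (cis s) * cnj (cis s)"
  have normal: "Re (cnj n * (A + B)) > 0"
    unfolding A_def B_def
  proof (rule normal_derivative_pos)
    show "Re (cnj n * (U x - U (cis s))) \<le> 0" if x: "x \<in> sphere 0 1" for x
    proof -
      obtain t where "U x = g t" using sphere_boundary[OF x] by blast
      then show ?thesis using support by (simp only: boundary)
    qed
    obtain t where "Re (cnj n * (g t - g s)) \<noteq> 0" using component_not_constant[OF n] by blast
    then show "\<exists>x\<in>sphere 0 1. Re (cnj n * (U x - U (cis s))) \<noteq> 0"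
      by (intro bexI[of _ "cis t"]) (simp_all only: boundary, simp_all)
  qed simp
  have vd: "((\<lambda>t. cnj n * (g t - g s)) has_vector_derivative cnj n * g' s) (at s)"
    by (auto intro!: derivative_eq_intros deriv_g)
  have "((\<lambda>t. Re (cnj n * (g t - g s))) has_real_derivative Re (cnj n * g' s)) (at s)"
    using bounded_linear.has_vector_derivative[OF bounded_linear_Re vd]
    by (simp only: has_real_derivative_iff_has_vector_derivative)
  then have "Re (cnj n * g' s) = 0"
    by (rule DERIV_local_max[where d = 1]) (use support in auto)
  then have "cnj n * g' s = \<i> * of_real (Im (cnj n * g' s))"
    by (simp only: complex_eq_iff) simp
  then have "n * cnj n * g' s = of_real (Im (cnj n * g' s)) * (\<i> * n)"
    by (metis mult.assoc mult.commute)
  then have "of_real ((norm n)\<^sup>2) * g' s = of_real (Im (cnj n * g' s)) * (\<i> * n)"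
    by (simp only: complex_norm_square)
  then have tangent: "g' s = of_real (Im (cnj n * g' s) / (norm n)\<^sup>2) * (\<i> * n)"
    using n by (simp add: field_simps)
  define c where "c = Im (cnj n * g' s) / (norm n)\<^sup>2"
  have c: "c > 0" by (rule supported_tangent_pos[OF n support tangent[folded c_def]])
  have "\<i> * (A - B) = g' s" by (simp only: tangent_eq A_def B_def)
  also have "\<dots> = \<i> * (of_real c * n)" unfolding tangent[folded c_def] by (rule mult.left_commute)
  finally have AB: "A - B = of_real c * n" unfolding mult_cancel_left by simp
  have "(norm A)\<^sup>2 - (norm B)\<^sup>2 = Re (cnj (A - B) * (A + B))"
    unfolding cmod_power2 by (simp add: power2_eq_square algebra_simps)
  also have "\<dots> = c * Re (cnj n * (A + B))"
    unfolding AB by (simp add: algebra_simps)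
  also have "\<dots> > 0" using c normal by simp
  finally have "(norm B)\<^sup>2 < (norm A)\<^sup>2" by simp
  then have "norm B < norm A" by (rule power_less_imp_less_base) simp
  then show ?thesis by (simp add: A_def B_def norm_mult)
qed

text \<open>A rightmost point of the curve; \<open>cnj 1\<close> keeps the form of a support
  inequality with normal 1.\<close>

lemma exists_supported_point:
  obtains s where "\<And>t. Re (cnj 1 * (g t - g s)) \<le> 0"
proof -
  have "continuous_on {0..2 * pi} (\<lambda>t. Re (g t))"
    by (intro continuous_intros continuous_on_subset[OF cont_g]) auto
  then obtain s where s: "\<And>t. t \<in> {0..2 * pi} \<Longrightarrow> Re (g t) \<le> Re (g s)"
    using continuous_attains_sup[of "{0..2 * pi}" "\<lambda>t. Re (g t)"] by fastforce
  show thesis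
  proof
    fix t
    have "g t \<in> path_image loop" using path_image_loop by simp
    then obtain r where "r \<in> {0..1}" "g t = g (2 * pi * r)" by (auto simp: path_image_def)
    moreover then have "2 * pi * r \<in> {0..2 * pi}" by (simp add: mult_left_le)
    ultimately show "Re (cnj 1 * (g t - g s)) \<le> 0" using s by simp
  qed
qed

lemma det_pos_if_boundary_det_pos:
  assumes pos: "\<And>z. z \<in> sphere 0 1 \<Longrightarrow> norm (b z) < norm (a z)" and z: "z \<in> cball 0 1"
  shows "norm (b z) < norm (a z)"
proof -
  obtain s where s: "\<And>t. Re (cnj 1 * (g t - g s)) \<le> 0" using exists_supported_point by blast
  define c where "c = Im (g' s)"
  have vd: "((\<lambda>t. g t - g s) has_vector_derivative g' s) (at s)"
    by (auto intro!: derivative_eq_intros deriv_g)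
  have "((\<lambda>t. Re (g t - g s)) has_real_derivative Re (g' s)) (at s)"
    using bounded_linear.has_vector_derivative[OF bounded_linear_Re vd]
    by (simp only: has_real_derivative_iff_has_vector_derivative)
  then have "Re (g' s) = 0"
    by (rule DERIV_local_max[where d = 1]) (use s in auto)
  then have tangent: "g' s = of_real c * (\<i> * 1)" by (simp add: complex_eq_iff c_def)
  have c: "c > 0" by (rule supported_tangent_pos[OF _ s tangent]) simp
  interpret S: supported_jordan_loop g g' s c 1
    by unfold_locales (use s tangent c in auto)
  define m where "m = cis s"
  have nm: "norm m = 1" by (simp add: m_def)
  have mz: "m * z \<in> sphere 0 1 \<longleftrightarrow> z \<in> sphere 0 1" "m * z \<in> cball 0 1 \<longleftrightarrow> z \<in> cball 0 1"
      "m * z \<in> ball 0 1 \<longleftrightarrow> z \<in> ball 0 1" for z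
    by (simp_all add: norm_mult nm)
  \<comment> \<open>rotated so that the loop starts at the support point\<close>
  define f where "f z = a (m * z)" for z
  let ?q = "\<lambda>t. g' (s + 2 * pi * t) / (\<i> * cis (s + 2 * pi * t))"
  have circ: "m * circlepath 0 1 t = cis (s + 2 * pi * t)" for t
    by (simp add: circlepath m_def cis_conv_exp exp_add algebra_simps)
  \<comment> \<open>By \<open>tangent_eq\<close> the two loops differ by
    \<open>b * cnj z / z\<close>, whose modulus is that of \<open>b\<close> and so smaller than that
    of \<open>a\<close>; the loops therefore wind equally often around 0.\<close>
  have fq: "norm (?q t - (f \<circ> circlepath 0 1) t) < norm ((f \<circ> circlepath 0 1) t - 0)" for t
  proof -
    let ?z = "cis (s + 2 * pi * t)"
    have "?q t - (f \<circ> circlepath 0 1) t = - (b ?z * cnj ?z / ?z)"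
      unfolding tangent_eq f_def o_def circ by (simp add: diff_divide_distrib)
    then have "norm (?q t - (f \<circ> circlepath 0 1) t) = norm (b ?z)"
      by (simp add: norm_mult norm_divide)
    also have "\<dots> < norm (a ?z)" by (rule pos) simp
    finally show ?thesis by (simp add: f_def circ)
  qed
  have contf: "continuous_on (cball 0 1) f"
    unfolding f_def by (intro continuous_on_compose2[OF cont_a] continuous_intros) (use mz in auto)
  have "winding_number ?q 0 = winding_number (f \<circ> circlepath 0 1) 0"
  proof (rule winding_number_nearby_loops_eq)
    show "path (f \<circ> circlepath 0 1)"
      by (rule path_continuous_image) (use contf in \<open>auto intro: continuous_on_subset\<close>)
    show "path ?q"
      unfolding path_def
      by (intro continuous_intros continuous_on_compose2[OF cont_deriv]) auto
    have "cis (s + 2 * pi) = cis s" by (simp flip: cis_mult)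
    then show "pathfinish ?q = pathstart ?q"
      using deriv_periodic[of "s + 2 * pi" s] by (simp add: pathfinish_def pathstart_def)
    show "pathfinish (f \<circ> circlepath 0 1) = pathstart (f \<circ> circlepath 0 1)"
      by (simp add: pathfinish_compose pathstart_compose)
  qed (rule fq)
  then have wn: "winding_number (f \<circ> circlepath 0 1) 0 = 0"
    using S.turning_number by simp
  have holf: "f holomorphic_on ball 0 1"
    unfolding f_def by (rule holomorphic_on_compose_gen[OF _ hol_a, unfolded o_def])
      (use mz in \<open>auto intro!: holomorphic_intros\<close>)
  have f_nz: "f w \<noteq> 0" if "w \<in> cball 0 1" for w
  proof (rule holomorphic_zero_free_if_winding_number_zero[OF holf contf _ wn that])
    show "f z \<noteq> 0" if "z \<in> sphere 0 1" for z
      using pos[of "m * z"] that mz(1)[of z] by (auto simp: f_def)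
  qed
  have a_nz: "a w \<noteq> 0" if "w \<in> cball 0 1" for w
  proof -
    have "m * (w / m) = w" using nm by auto
    then show ?thesis using f_nz[of "w / m"] mz(2)[of "w / m"] that by (simp add: f_def)
  qed
  define q where "q w = cnj (b w) / a w" for w
  have contq: "continuous_on (cball 0 1) q"
    unfolding q_def by (intro continuous_intros cont_a cont_b) (use a_nz in auto)
  have holq: "q holomorphic_on ball 0 1"
    unfolding q_def by (intro holomorphic_intros hol_a hol_b) (use a_nz in auto)
  have "sphere (0::complex) 1 \<noteq> {}" by simp
  then obtain x where x: "x \<in> sphere 0 1" "\<And>y. y \<in> sphere 0 1 \<Longrightarrow> norm (q y) \<le> norm (q x)"
    using continuous_attains_sup[OF compact_sphere _ continuous_on_norm[OF continuous_on_subset[OF contq sphere_cball]]]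
    by blast
  have "norm (q z) \<le> norm (q x)"
    by (rule maximum_modulus_frontier[of q "cball 0 1"]) (use holq contq x z in auto)
  also have "\<dots> < 1" using pos[OF x(1)] by (simp add: q_def norm_divide divide_less_eq)
  finally show ?thesis using a_nz[OF z] by (simp add: q_def norm_divide divide_less_eq)
qed

end

section \<open>Global injectivity\<close>

locale kneser_map = kneser_problem +
  assumes det_pos: "\<And>z. z \<in> cball 0 1 \<Longrightarrow> norm (b z) < norm (a z)"
begin

text \<open>The derivative at \<open>x\<close> expands lengths by at least \<open>\<alpha>\<close>,
  and \<open>U\<close> minus it is Lipschitz with constant \<open>\<alpha> / 2\<close> on a small
  convex piece of the disc. The argument also covers points of the circle, which are not interior to
  the domain.\<close>

lemma locally_injective:
  assumes x: "x \<in> cball 0 1"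
  obtains d where "d > 0" "inj_on U (ball x d \<inter> cball 0 1)"
proof -
  define \<alpha> where "\<alpha> = norm (a x) - norm (b x)"
  have \<alpha>: "\<alpha> > 0" using det_pos[OF x] by (simp add: \<alpha>_def)
  have "continuous (at x within cball 0 1) (\<lambda>y. norm (a y - a x) + norm (b y - b x))"
    using x cont_a cont_b by (intro continuous_intros) (auto simp: continuous_on_eq_continuous_within)
  then obtain d where d: "d > 0" "\<And>y. y \<in> cball 0 1 \<Longrightarrow> dist y x < d \<Longrightarrow>
      norm (a y - a x) + norm (b y - b x) < \<alpha> / 2"
  proof -
    let ?F = "\<lambda>y. norm (a y - a x) + norm (b y - b x)"
    assume thesis': "\<And>d. d > 0 \<Longrightarrow> (\<And>y. y \<in> cball 0 1 \<Longrightarrow> dist y x < d \<Longrightarrow> ?F y < \<alpha> / 2) \<Longrightarrow> thesis"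
    assume "continuous (at x within cball 0 1) ?F"
    then obtain d where "d > 0" and d: "\<And>y. y \<in> cball 0 1 \<Longrightarrow> dist y x < d \<Longrightarrow> dist (?F y) (?F x) < \<alpha> / 2"
      unfolding continuous_within_eps_delta using half_gt_zero[OF \<alpha>] by blast
    have "?F y < \<alpha> / 2" if "y \<in> cball 0 1" "dist y x < d" for y
      using d[OF that] by (simp add: dist_real_def)
    then show thesis using thesis' \<open>d > 0\<close> by blast
  qed
  let ?S = "ball x d \<inter> cball 0 1"
  let ?V = "\<lambda>y. U y - (a x * y + b x * cnj y)"
  let ?V' = "\<lambda>y h. (a y * h + b y * cnj h) - (a x * h + b x * cnj h)"
  have V: "norm (?V y - ?V z) \<le> \<alpha> / 2 * norm (y - z)" if "y \<in> ?S" "z \<in> ?S" for y z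
  proof (rule differentiable_bound[where f = ?V and f' = ?V' and S = ?S])
    show "convex ?S" by (intro convex_Int) auto
    fix w assume w: "w \<in> ?S"
    show "(?V has_derivative ?V' w) (at w within ?S)"
      using w by (intro has_derivative_diff has_derivative_add has_derivative_mult_right has_derivative_cnj
        has_derivative_ident has_derivative_subset[OF der]) auto
    show "onorm (?V' w) \<le> \<alpha> / 2"
    proof (rule onorm_le)
      fix h
      have "?V' w h = (a w - a x) * h + (b w - b x) * cnj h" by (simp add: algebra_simps)
      then have "norm (?V' w h) \<le> norm (a w - a x) * norm h + norm (b w - b x) * norm h"
        by (metis norm_triangle_ineq norm_mult complex_mod_cnj)
      also have "\<dots> = (norm (a w - a x) + norm (b w - b x)) * norm h" by (simp add: distrib_right)
      also have "\<dots> \<le> \<alpha> / 2 * norm h"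
        using d(2)[of w] w by (intro mult_right_mono) (auto simp: dist_commute less_imp_le)
      finally show "norm (?V' w h) \<le> \<alpha> / 2 * norm h" .
    qed
  qed (use that in auto)
  have "inj_on U ?S"
  proof (rule inj_onI)
    fix y z assume y: "y \<in> ?S" and z: "z \<in> ?S" and eq: "U y = U z"
    have "\<alpha> * norm (y - z) \<le> norm (a x * (y - z) + b x * cnj (y - z))"
      unfolding \<alpha>_def by (rule inj_derivative_lower_bound)
    also have "\<dots> = norm (?V y - ?V z)"
      using eq by (subst norm_minus_cancel[symmetric]) (simp add: algebra_simps)
    also have "\<dots> \<le> \<alpha> / 2 * norm (y - z)" by (rule V[OF y z])
    finally have "\<alpha> / 2 * norm (y - z) \<le> 0" by (simp add: field_simps)
    then show "y = z" using \<alpha> by (simp add: mult_le_0_iff)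
  qed
  then show thesis using that d(1) by blast
qed

lemma open_map:
  assumes W: "open W" "W \<subseteq> ball 0 1"
  shows "open (U ` W)"
proof (rule openI)
  fix y assume "y \<in> U ` W"
  then obtain x where x: "x \<in> W" "y = U x" by blast
  then obtain d where d: "d > 0" "inj_on U (ball x d \<inter> cball 0 1)"
    using locally_injective[of x] W by (metis ball_subset_cball subsetD)
  let ?V = "ball x d \<inter> W"
  have sub: "?V \<subseteq> ball x d \<inter> cball 0 1" using W ball_subset_cball by blast
  have "open (U ` ?V)"
  proof (rule invariance_of_domain)
    show "continuous_on ?V U" using cont_U sub continuous_on_subset by blast
    show "inj_on U ?V" using d(2) sub inj_on_subset by blast
  qed (use W in auto)
  moreover have "y \<in> U ` ?V" using x d(1) by auto
  ultimately obtain e where "e > 0" "ball y e \<subseteq> U ` ?V" by (rule openE)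
  then show "\<exists>e>0. ball y e \<subseteq> U ` W" by blast
qed

lemma image_sphere: "U ` sphere 0 1 = range g"
  unfolding range_cis[symmetric] image_image boundary ..

lemma cball_eq: "cball (0::complex) 1 = ball 0 1 \<union> sphere 0 1"
  by auto

text \<open>Off the curve the image of the open disc is both open and closed, since the compact
  image of the closed disc adds only the curve. The unbounded outside cannot be covered by a compact
  image, so it is missed; \<open>D\<close> is met, so it is covered.\<close>

lemma image_ball: "U ` ball 0 1 = D"
proof -
  have op: "open (U ` ball 0 1)" by (rule open_map) auto
  have "compact (U ` cball 0 1)" by (rule compact_continuous_image[OF cont_U]) simp
  then have cl: "closed (U ` cball 0 1)" and bd: "bounded (U ` cball 0 1)"
    by (auto intro: compact_imp_closed compact_imp_bounded)
  have un: "U ` cball 0 1 = U ` ball 0 1 \<union> range g" by (simp only: cball_eq image_Un image_sphere)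
  have out_disj: "U ` ball 0 1 \<inter> outside (range g) = {}"
  proof (rule ccontr)
    assume ne: "U ` ball 0 1 \<inter> outside (range g) \<noteq> {}"
    have "\<not> outside (range g) \<subseteq> U ` cball 0 1" using Jordan bd bounded_subset by blast
    then have 1: "- (U ` cball 0 1) \<inter> outside (range g) \<noteq> {}" by blast
    have "outside (range g) \<inter> range g = {}" using Jordan by blast
    then have 2: "outside (range g) \<subseteq> U ` ball 0 1 \<union> - (U ` cball 0 1)" unfolding un by blast
    have 3: "U ` ball 0 1 \<inter> - (U ` cball 0 1) \<inter> outside (range g) = {}" unfolding un by blast
    have "connected (outside (range g))" using Jordan by blast
    from connectedD[OF this op open_Compl[OF cl] 3 2] show False using ne 1 by blast
  qed
  \<comment> \<open>An open set that misses the outside also misses its closure, hence the curve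
    itself; only \<open>D\<close> is left.\<close>
  have "U ` ball 0 1 \<inter> closure (outside (range g)) = {}"
    using out_disj op by (simp add: open_Int_closure_eq_empty)
  moreover have "frontier (outside (range g)) = range g" using Jordan by (elim conjE)
  then have "range g \<subseteq> closure (outside (range g))" by (metis Diff_subset frontier_def)
  moreover have "inside (range g) \<union> outside (range g) = - range g" using Jordan by (elim conjE)
  ultimately have sub: "U ` ball 0 1 \<subseteq> D"
    using out_disj unfolding D_eq_inside by blast
  have "D \<subseteq> U ` ball 0 1"
  proof (rule ccontr)
    assume "\<not> D \<subseteq> U ` ball 0 1"
    then have "- (U ` cball 0 1) \<inter> D \<noteq> {}" using un D_disjoint_range by blast
    moreover have "U 0 \<in> U ` ball 0 1" by simp
    then have "U ` ball 0 1 \<inter> D \<noteq> {}" using sub by blast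
    moreover have "D \<subseteq> U ` ball 0 1 \<union> - (U ` cball 0 1)" using un D_disjoint_range by blast
    moreover have "U ` ball 0 1 \<inter> - (U ` cball 0 1) \<inter> D = {}" using un by blast
    ultimately show False
      using connectedD[OF D(2) op open_Compl[OF cl]] by blast
  qed
  then show ?thesis using sub by blast
qed

lemma image_cball: "U ` cball 0 1 = closure D"
  unfolding cball_eq image_Un image_ball image_sphere closure_Un_frontier D(4) ..

lemma inj_on_sphere: "inj_on U (sphere 0 1)"
proof (rule inj_onI)
  fix x y assume "x \<in> sphere 0 1" "y \<in> sphere 0 1" "U x = U y"
  then obtain s t where "x = cis s" "y = cis t" "g s = g t"
    using sphere_boundary by metis
  then show "x = y" using g_eq_iff by simp
qed

text \<open>Local injectivity keeps double points away from the diagonal, so their set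
  \<open>P\<close> is compact and its projection \<open>T\<close> is closed. \<open>T\<close> is
  open because double points are interior and \<open>U\<close> is open there. It omits 1, so it is
  empty by connectedness of the plane.\<close>

lemma injective: "inj_on U (cball 0 1)"
proof -
  define E where "E = {p \<in> cball 0 1 \<times> cball 0 1. U (fst p) - U (snd p) = 0}"
  define P where "P = {p \<in> E. fst p \<noteq> snd p}"
  have "\<exists>d>0. inj_on U (ball x d \<inter> cball 0 1)" if "x \<in> cball 0 1" for x
    using locally_injective[OF that] by blast
  then obtain d where d: "\<And>x. x \<in> cball 0 1 \<Longrightarrow> d x > 0"
    "\<And>x. x \<in> cball 0 1 \<Longrightarrow> inj_on U (ball x (d x) \<inter> cball 0 1)" by metis
  \<comment> \<open>A neighbourhood of the diagonal in which distinct points of the disc have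
    distinct values, so removing it from \<open>E\<close> removes exactly the diagonal.\<close>
  define V where "V = (\<Union>x\<in>cball 0 1. ball x (d x) \<times> ball x (d x))"
  have "open V" unfolding V_def by (intro open_UN ballI open_Times open_ball)
  have "closed E"
  proof -
    have "continuous_on (cball 0 1 \<times> cball 0 1) (\<lambda>p. U (fst p) - U (snd p))"
      by (intro continuous_intros continuous_on_compose2[OF cont_U]) auto
    then have "closed ((cball 0 1 \<times> cball 0 1) \<inter> (\<lambda>p. U (fst p) - U (snd p)) -` {0})"
      by (rule continuous_closed_preimage) (auto intro: closed_Times)
    moreover have "E = (cball 0 1 \<times> cball 0 1) \<inter> (\<lambda>p. U (fst p) - U (snd p)) -` {0}"
      by (auto simp: E_def)
    ultimately show ?thesis by simp
  qed
  moreover have "P = E - V"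
  proof
    show "P \<subseteq> E - V"
    proof
      fix p assume p: "p \<in> P"
      then have pE: "fst p \<in> cball 0 1" "snd p \<in> cball 0 1" "U (fst p) = U (snd p)" "fst p \<noteq> snd p"
        by (auto simp: P_def E_def)
      have "p \<notin> V"
      proof
        assume "p \<in> V"
        then obtain x where "x \<in> cball 0 1" "fst p \<in> ball x (d x)" "snd p \<in> ball x (d x)"
          by (auto simp: V_def)
        then show False using d(2)[of x] pE by (metis IntI inj_onD)
      qed
      then show "p \<in> E - V" using p by (simp add: P_def)
    qed
    show "E - V \<subseteq> P"
    proof
      fix p assume p: "p \<in> E - V"
      have "fst p \<noteq> snd p"
      proof
        assume eq: "fst p = snd p"
        have "fst p \<in> cball 0 1" using p by (auto simp: E_def)
        then have "p \<in> V" using d(1)[of "fst p"] eq unfolding V_def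
          by (intro UN_I[of "fst p"]) (auto simp: mem_Times_iff)
        then show False using p by simp
      qed
      then show "p \<in> P" using p by (simp add: P_def)
    qed
  qed
  ultimately have "closed P" using \<open>open V\<close> by (simp add: closed_Diff)
  moreover have "P \<subseteq> cball 0 1 \<times> cball 0 1" by (auto simp: P_def E_def)
  ultimately have "compact P"
    using bounded_subset[OF compact_imp_bounded[OF compact_Times[OF compact_cball compact_cball]]]
    unfolding compact_eq_bounded_closed by blast
  define T where "T = fst ` P"
  have "closed T" unfolding T_def
    by (intro compact_imp_closed compact_continuous_image \<open>compact P\<close> continuous_intros)
  \<comment> \<open>Interior points go to \<open>D\<close> and points of the circle to its frontier,
    so the two partners are of the same kind; two points of the circle never share a value.\<close>
  have T_iff: "x \<in> T \<longleftrightarrow> x \<in> ball 0 1 \<and> (\<exists>y\<in>ball 0 1. y \<noteq> x \<and> U y = U x)" for x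
  proof
    assume "x \<in> T"
    then obtain y where y: "x \<in> cball 0 1" "y \<in> cball 0 1" "U x = U y" "x \<noteq> y"
      by (auto simp: T_def P_def E_def)
    have *: "x \<in> sphere 0 1 \<longleftrightarrow> y \<in> sphere 0 1"
      using y(1-3) D_disjoint_range image_ball image_sphere unfolding cball_eq by blast
    moreover have "x \<notin> sphere 0 1" using * inj_on_sphere y(3,4) by (metis inj_onD)
    ultimately show "x \<in> ball 0 1 \<and> (\<exists>y\<in>ball 0 1. y \<noteq> x \<and> U y = U x)"
      using y unfolding cball_eq by (metis UnE)
  next
    assume "x \<in> ball 0 1 \<and> (\<exists>y\<in>ball 0 1. y \<noteq> x \<and> U y = U x)"
    then obtain y where "x \<in> ball 0 1" "y \<in> ball 0 1" "y \<noteq> x" "U y = U x" by blast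
    then have "(x, y) \<in> P" by (auto simp: P_def E_def)
    then show "x \<in> T" unfolding T_def by force
  qed
  have "open T"
  proof (rule openI)
    fix x assume "x \<in> T"
    then obtain y where xy: "x \<in> ball 0 1" "y \<in> ball 0 1" "y \<noteq> x" "U y = U x" using T_iff by blast
    then obtain A B where AB: "open A" "open B" "x \<in> A" "y \<in> B" "A \<inter> B = {}"
      using hausdorff[of x y] by auto
    \<comment> \<open>For \<open>z\<close> near \<open>x\<close> the open image of a neighbourhood
      of \<open>y\<close> supplies a partner in \<open>B\<close>; disjointness of \<open>A\<close>
      and \<open>B\<close> keeps it different from \<open>z\<close>.\<close>
    define W where "W = U -` (U ` (B \<inter> ball 0 1)) \<inter> (A \<inter> ball 0 1)"
    have "open (U ` (B \<inter> ball 0 1))" using AB by (intro open_map) auto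
    moreover have "continuous_on (A \<inter> ball 0 1) U"
      by (rule continuous_on_subset[OF cont_U]) auto
    ultimately have "open W"
      unfolding W_def using AB by (subst Int_commute, intro continuous_open_preimage) auto
    moreover have "x \<in> W" using xy AB by (auto simp: W_def intro: image_eqI[of _ _ y])
    ultimately obtain e where "e > 0" "ball x e \<subseteq> W" by (rule openE)
    moreover have "W \<subseteq> T"
    proof
      fix z assume z: "z \<in> W"
      then obtain y' where "y' \<in> B \<inter> ball 0 1" "U z = U y'" by (auto simp: W_def)
      moreover have "z \<in> A" "z \<in> ball 0 1" using z by (auto simp: W_def)
      ultimately show "z \<in> T" unfolding T_iff using AB(5) by (metis IntD1 IntD2 disjoint_iff)
    qed
    ultimately show "\<exists>e>0. ball x e \<subseteq> T" by blast
  qed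
  have "1 \<notin> T" using T_iff by simp
  then have "T = {}"
    using clopen[of T] \<open>open T\<close> \<open>closed T\<close> by blast
  show ?thesis
  proof (rule inj_onI)
    fix x y assume "x \<in> cball 0 1" "y \<in> cball 0 1" "U x = U y"
    moreover have "x \<noteq> y \<Longrightarrow> x \<in> T" using calculation by (force simp: T_def P_def E_def)
    ultimately show "x = y" using \<open>T = {}\<close> by blast
  qed
qed

lemma inverse_C1:
  "\<exists>G. (\<forall>x\<in>cball 0 1. G (U x) = x) \<and> (\<forall>y\<in>closure D. U (G y) = y) \<and> C1_on (closure D) G"
proof (intro exI conjI ballI)
  define G where "G = inv_into (cball 0 1) U"
  show GU: "G (U x) = x" if "x \<in> cball 0 1" for x
    unfolding G_def by (rule inv_into_f_f[OF injective that])
  show "U (G y) = y" if "y \<in> closure D" for y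
    unfolding G_def by (rule f_inv_into_f) (use that image_cball in auto)
  have G_in: "G y \<in> cball 0 1" if "y \<in> closure D" for y
    unfolding G_def by (rule inv_into_into) (use that image_cball in auto)
  have contG: "continuous_on (closure D) G"
    unfolding image_cball[symmetric] by (rule continuous_on_inv[OF cont_U]) (auto simp: GU)
  \<comment> \<open>Cramer's rule in Wirtinger form: the inverse of the map taking \<open>h\<close>
    to \<open>a * h + b * cnj h\<close>, with the Jacobian determinant as denominator.\<close>
  define L where "L y h = (cnj (a (G y)) * h - b (G y) * cnj h) / of_real ((norm (a (G y)))\<^sup>2 - (norm (b (G y)))\<^sup>2)"
    for y h
  have bl: "bounded_linear (L y)" for y
    unfolding L_def
    by (intro bounded_linear_intros bounded_linear_sub bounded_linear_compose[OF bounded_linear_divide]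
        bounded_linear_compose[OF bounded_linear_mult_right bounded_linear_cnj] bounded_linear_mult_right)
  have nz: "(norm (a x))\<^sup>2 - (norm (b x))\<^sup>2 \<noteq> 0" if "x \<in> cball 0 1" for x
  proof -
    have "(norm (b x))\<^sup>2 < (norm (a x))\<^sup>2" using det_pos[OF that] by (rule power_strict_mono) auto
    then show ?thesis by linarith
  qed
  show "C1_on (closure D) G"
    unfolding C1_on_def
  proof (intro exI conjI ballI)
    fix y assume y: "y \<in> closure D"
    define x where "x = G y"
    have x: "x \<in> cball 0 1" "y = U x" using G_in[OF y] \<open>\<And>y. y \<in> closure D \<Longrightarrow> U (G y) = y\<close>[OF y] by (auto simp: x_def)
    have "(G has_derivative L y) (at (U x) within U ` cball 0 1)"
    proof (rule has_derivative_inverse_within[OF der[OF x(1)] _ x(1)])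
      show "continuous (at (U x) within U ` cball 0 1) G"
        using contG y unfolding image_cball x(2) by (simp add: continuous_on_eq_continuous_within)
      show "linear (L y)" using bl by (rule bounded_linear.linear)
      show "L y \<circ> (\<lambda>h. a x * h + b x * cnj h) = id"
      proof
        fix h
        have "cnj (a x) * (a x * h + b x * cnj h) - b x * cnj (a x * h + b x * cnj h)
            = h * (a x * cnj (a x) - b x * cnj (b x))" by (simp add: algebra_simps)
        also have "\<dots> = h * of_real ((norm (a x))\<^sup>2 - (norm (b x))\<^sup>2)"
          by (simp only: complex_norm_square of_real_diff)
        finally show "(L y \<circ> (\<lambda>h. a x * h + b x * cnj h)) h = id h"
          using nz[OF x(1)] unfolding L_def x_def[symmetric] o_def id_def by (simp del: of_real_diff)
      qed
    qed (use GU in auto)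
    then show "(G has_derivative blinfun_apply (Blinfun (L y))) (at y within closure D)"
      using bl by (simp add: bounded_linear_Blinfun_apply image_cball x(2))
  next
    show "continuous_on (closure D) (\<lambda>y. Blinfun (L y))"
    proof (rule continuous_on_blinfun_componentwise)
      fix i :: complex
      have "continuous_on (closure D) (\<lambda>y. L y i)"
        unfolding L_def
        by (intro continuous_intros continuous_on_compose2[OF cont_a contG] continuous_on_compose2[OF cont_b contG])
          (use G_in nz in \<open>auto simp del: of_real_diff\<close>)
      then show "continuous_on (closure D) (\<lambda>y. blinfun_apply (Blinfun (L y)) i)"
        using bl by (simp add: bounded_linear_Blinfun_apply)
    qed
  qed
qed

end

section \<open>Necessity of the determinant condition, and the convex part of the boundary\<close>

context kneser_problem
begin

lemma det_nonzero_if_diffeo: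
  assumes "diffeo_onto (cball 0 1) T U" and x: "x \<in> cball 0 1"
  shows "norm (a x) \<noteq> norm (b x)"
proof
  assume eq: "norm (a x) = norm (b x)"
  obtain G where G: "U ` cball 0 1 = T" "\<And>y. y \<in> cball 0 1 \<Longrightarrow> G (U y) = y" "C1_on T G"
    using assms(1) unfolding diffeo_onto_def by blast
  then obtain G' where G': "(G has_derivative blinfun_apply (G' (U x))) (at (U x) within U ` cball 0 1)"
    using x unfolding C1_on_def by blast
  have "((\<lambda>y. G (U y)) has_derivative (\<lambda>h. blinfun_apply (G' (U x)) (a x * h + b x * cnj h))) (at x within cball 0 1)"
    using has_derivative_in_compose[OF der[OF x] G'] .
  then have "((\<lambda>y. y) has_derivative (\<lambda>h. blinfun_apply (G' (U x)) (a x * h + b x * cnj h))) (at x within cball 0 1)"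
    by (rule has_derivative_transform[rotated 2]) (use G(2) x in auto)
  then have id: "(\<lambda>h. blinfun_apply (G' (U x)) (a x * h + b x * cnj h)) = (\<lambda>h. h)"
    using has_derivative_unique_cball[OF _ has_derivative_ident x] by blast
  have "\<exists>h. h \<noteq> 0 \<and> a x * h + b x * cnj h = 0"
  proof (cases "a x = 0")
    case True
    then show ?thesis using eq by (intro exI[of _ 1]) auto
  next
    case False
    \<comment> \<open>After multiplication by a unimodular \<open>h\<close>, the equation
      \<open>a * h + b * cnj h = 0\<close> reads \<open>a * h^2 = - b\<close>; equality of the two
      moduli makes the square root unimodular.\<close>
    define h where "h = csqrt (- b x / a x)"
    have h2: "a x * (h * h) = - b x" using False by (simp add: h_def flip: power2_eq_square)
    have "b x \<noteq> 0" using False eq by (metis norm_eq_zero)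
    then have "norm (h * h) = 1" using eq by (simp add: h_def norm_divide flip: power2_eq_square)
    moreover have "h * cnj h = of_real (norm (h * h))"
      unfolding complex_norm_square[symmetric] power2_eq_square norm_mult ..
    ultimately have hh: "h * cnj h = 1" by (simp only: of_real_1)
    have "(a x * h + b x * cnj h) * h = 0" using h2 hh by (simp add: algebra_simps)
    then show ?thesis using hh by (intro exI[of _ h]) auto
  qed
  then obtain h where "h \<noteq> 0" "a x * h + b x * cnj h = 0" by blast
  then show False using fun_cong[OF id, of h] by simp
qed

text \<open>Invertibility of the derivative leaves the sign open. A support point fixes it, and
  connectedness of the disc carries it to every other point.\<close>

lemma det_pos_if_diffeo:
  assumes diffeo: "diffeo_onto (cball 0 1) T U" and x: "x \<in> cball 0 1"
  shows "norm (b x) < norm (a x)"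
proof (rule ccontr)
  assume neg: "\<not> norm (b x) < norm (a x)"
  obtain s where "\<And>t. Re (cnj 1 * (g t - g s)) \<le> 0" using exists_supported_point by blast
  then have pos: "norm (b (cis s)) < norm (a (cis s))" by (intro det_pos_at_support[of 1]) auto
  let ?f = "\<lambda>z. norm (a z) - norm (b z)"
  have "connected (?f ` cball 0 1)"
    by (intro connected_continuous_image continuous_intros cont_a cont_b) (simp add: convex_connected)
  moreover have "?f x \<in> ?f ` cball 0 1" "?f (cis s) \<in> ?f ` cball 0 1" using x by auto
  ultimately have "0 \<in> ?f ` cball 0 1"
    by (rule connectedD_interval) (use neg pos in auto)
  then show False using det_nonzero_if_diffeo[OF diffeo] by auto
qed

text \<open>\<open>frechet_derivative\<close> within a set is a choice among derivatives; uniqueness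
  on the closed disc identifies it, also at points of the circle.\<close>

lemma jacobian_det_eq:
  assumes z: "z \<in> cball 0 1"
  shows "jacobian_det (cball 0 1) U z = (norm (a z))\<^sup>2 - (norm (b z))\<^sup>2"
proof -
  have "U differentiable (at z within cball 0 1)" using der[OF z] by (auto simp: differentiable_def)
  then have "(U has_derivative frechet_derivative U (at z within cball 0 1)) (at z within cball 0 1)"
    by (simp add: frechet_derivative_works)
  then have "frechet_derivative U (at z within cball 0 1) = (\<lambda>h. a z * h + b z * cnj h)"
    using has_derivative_unique_cball[OF _ der[OF z] z] by blast
  then show ?thesis
    unfolding jacobian_det_def Let_def cmod_power2 by (simp add: power2_eq_square algebra_simps)
qed

text \<open>The hull of an open set is open, so a frontier point lies outside its relative interior
  and has a supporting hyperplane. The normal \<open>v\<close> obtained points inwards, hence the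
  change of sign.\<close>

lemma det_pos_at_convex_part:
  assumes "g s \<in> frontier (convex hull D)"
  shows "norm (b (cis s)) < norm (a (cis s))"
proof -
  have op: "open (convex hull D)" by (rule open_convex_hull[OF D(1)])
  have "g s \<in> closure (convex hull D)" "g s \<notin> rel_interior (convex hull D)"
    using assms op by (auto simp: frontier_def rel_interior_open interior_open)
  then obtain v where v: "v \<noteq> 0" "\<And>y. y \<in> closure (convex hull D) \<Longrightarrow> v \<bullet> g s \<le> v \<bullet> y"
    using supporting_hyperplane_relative_frontier[OF convex_convex_hull, of "g s" D] by metis
  show ?thesis
  proof (rule det_pos_at_support)
    show "- v \<noteq> 0" using v(1) by simp
    fix t
    have "g t \<in> closure D" using D(4) by (metis Diff_iff frontier_def rangeI)
    then have "g t \<in> closure (convex hull D)" using closure_mono[OF hull_subset] by blast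
    then have "v \<bullet> g s \<le> v \<bullet> g t" by (rule v(2))
    then show "Re (cnj (- v) * (g t - g s)) \<le> 0" by (simp add: inner_complex_def algebra_simps)
  qed
qed

lemma det_pos_if_nonconvex_part_det_pos:
  assumes nc: "\<And>z. z \<in> sphere 0 1 \<Longrightarrow> U z \<in> nonconvex_part D \<Longrightarrow> norm (b z) < norm (a z)"
    and z: "z \<in> cball 0 1"
  shows "norm (b z) < norm (a z)"
proof (rule det_pos_if_boundary_det_pos[OF _ z])
  fix x :: complex assume x: "x \<in> sphere 0 1"
  then obtain s where s: "x = cis s" "U x = g s" by (rule sphere_boundary)
  show "norm (b x) < norm (a x)"
  proof (cases "g s \<in> frontier (convex hull D)")
    case True
    then show ?thesis unfolding s(1) by (rule det_pos_at_convex_part)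
  next
    case False
    then have "U x \<in> nonconvex_part D" unfolding nonconvex_part_def D(4) s(2) by simp
    then show ?thesis by (rule nc[OF x])
  qed
qed

lemma diffeo_if_det_pos:
  assumes "\<And>z. z \<in> cball 0 1 \<Longrightarrow> norm (b z) < norm (a z)" "C1_on (cball 0 1) U"
  shows "diffeo_onto (cball 0 1) (closure D) U"
proof -
  interpret kneser_map U a b g g' D by unfold_locales (rule assms(1))
  show ?thesis unfolding diffeo_onto_def using inverse_C1 image_cball assms(2) by blast
qed

end

theorem theorem5p2:
  fixes \<Phi> U :: "complex \<Rightarrow> complex" and \<phi>' :: "real \<Rightarrow> complex"
    and \<gamma> D :: "complex set"
  assumes Phi_C1: "\<And>t. ((\<lambda>s. \<Phi> (cis s)) has_vector_derivative \<phi>' t) (at t)"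
      and Phi_C1_cont: "continuous_on UNIV \<phi>'"
      and Phi_regular: "\<And>t. \<phi>' t \<noteq> 0"
      and Phi_inj: "inj_on \<Phi> (sphere 0 1)"
      and Phi_onto: "\<Phi> ` sphere 0 1 = \<gamma>"
      and D_open: "open D" and D_conn: "connected D" and D_bdd: "bounded D"
      and D_bdry: "frontier D = \<gamma>"
      and Phi_orient: "\<And>z. z \<in> D \<Longrightarrow> winding_number (\<lambda>t. \<Phi> (exp (2 * pi * \<i> * of_real t))) z = 1"
      and U_C2: "C2_on (ball 0 1) U"
      and U_harm: "\<And>z. z \<in> ball 0 1 \<Longrightarrow> laplacian U z = 0"
      and U_bdry: "\<And>z. z \<in> sphere 0 1 \<Longrightarrow> U z = \<Phi> z"
      and U_C1: "C1_on (cball 0 1) U"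
  shows "diffeo_onto (cball 0 1) (closure D) U \<longleftrightarrow>
         (\<forall>z\<in>sphere 0 1. \<Phi> z \<in> nonconvex_part D \<longrightarrow> jacobian_det (cball 0 1) U z > 0)"
proof -
  obtain F' where F': "\<And>x. x \<in> cball 0 1 \<Longrightarrow> (U has_derivative blinfun_apply (F' x)) (at x within cball 0 1)"
    and contF': "continuous_on (cball 0 1) F'"
    using U_C1 unfolding C1_on_def by blast
  obtain f' f'' where f'0: "\<And>x. x \<in> ball 0 1 \<Longrightarrow> (U has_derivative blinfun_apply (f' x)) (at x within ball 0 1)"
    and f''0: "\<And>x. x \<in> ball 0 1 \<Longrightarrow> (f' has_derivative blinfun_apply (f'' x)) (at x within ball 0 1)"
    using U_C2 unfolding C2_on_def by blast
  have f': "(U has_derivative blinfun_apply (f' x)) (at x)" if "x \<in> ball 0 1" for x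
    using f'0[OF that] at_within_open[OF that open_ball] by simp
  have f'': "(f' has_derivative blinfun_apply (f'' x)) (at x)" if "x \<in> ball 0 1" for x
    using f''0[OF that] at_within_open[OF that open_ball] by simp
  \<comment> \<open>Continuity up to the circle is known for \<open>F'\<close>, a second derivative
    for \<open>f'\<close>. Their agreement in the open disc gives \<open>a\<close> and
    \<open>b\<close> both continuity on the closed disc and holomorphy inside.\<close>
  have eq: "f' x = F' x" if x: "x \<in> ball 0 1" for x
  proof -
    have "x \<in> interior (cball 0 1)" using x by simp
    then have "at x within cball 0 1 = at x" by (rule at_within_interior)
    then have "blinfun_apply (f' x) = blinfun_apply (F' x)"
      using has_derivative_unique[OF f'[OF x]] F'[of x] x by simp
    then show ?thesis by (simp add: blinfun_apply_inject)
  qed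
  define a where "a x = wirt (F' x)" for x
  define b where "b x = wirt_bar (F' x)" for x
  have app: "blinfun_apply (F' x) = (\<lambda>h. a x * h + b x * cnj h)" for x
    by (rule ext) (simp add: a_def b_def blinfun_apply_wirt)
  define g where "g t = \<Phi> (cis t)" for t
  have range_g: "range g = \<gamma>"
    unfolding Phi_onto[symmetric] range_cis[symmetric] g_def by (simp only: image_image)
  interpret kneser_problem U a b g \<phi>' D
  proof
    show "(U has_derivative (\<lambda>h. a x * h + b x * cnj h)) (at x within cball 0 1)" if "x \<in> cball 0 1" for x
      using F'[OF that] by (simp only: app)
    show "continuous_on (cball 0 1) a" "continuous_on (cball 0 1) b"
      unfolding a_def b_def by (rule continuous_on_wirt[OF contF'])+
    show "a holomorphic_on ball 0 1"
      by (rule holomorphic_transform[OF harmonic_imp_wirt_holomorphic(1)[OF open_ball f' f'' U_harm]])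
        (auto simp: a_def eq)
    show "(\<lambda>x. cnj (b x)) holomorphic_on ball 0 1"
      by (rule holomorphic_transform[OF harmonic_imp_wirt_holomorphic(2)[OF open_ball f' f'' U_harm]])
        (auto simp: b_def eq)
    show "(g has_vector_derivative \<phi>' t) (at t)" for t
      using Phi_C1 unfolding g_def .
    show "g s = g t \<longleftrightarrow> cis s = cis t" for s t
      unfolding g_def using Phi_inj by (intro inj_on_eq_iff) auto
    show "frontier D = range g" by (simp only: D_bdry range_g)
    show "winding_number (\<lambda>t. g (2 * pi * t)) z = 1" if "z \<in> D" for z
    proof -
      have "g (2 * pi * t) = \<Phi> (exp (2 * pi * \<i> * of_real t))" for t
        by (simp add: g_def cis_conv_exp mult_ac)
      then show ?thesis using Phi_orient[OF that] by simp
    qed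
    show "U (cis t) = g t" for t using U_bdry by (simp add: g_def)
  qed (rule Phi_C1_cont Phi_regular D_open D_conn D_bdd)+
  have jac: "jacobian_det (cball 0 1) U z > 0 \<longleftrightarrow> norm (b z) < norm (a z)" if "z \<in> cball 0 1" for z
    unfolding jacobian_det_eq[OF that] by (auto intro: power_strict_mono power_less_imp_less_base)
  have sub: "z \<in> cball 0 1" if "z \<in> sphere 0 1" for z :: complex using that by auto
  show ?thesis
  proof
    assume "diffeo_onto (cball 0 1) (closure D) U"
    then show "\<forall>z\<in>sphere 0 1. \<Phi> z \<in> nonconvex_part D \<longrightarrow> jacobian_det (cball 0 1) U z > 0"
      using jac[OF sub] det_pos_if_diffeo[OF _ sub] by simp
  next
    assume *: "\<forall>z\<in>sphere 0 1. \<Phi> z \<in> nonconvex_part D \<longrightarrow> jacobian_det (cball 0 1) U z > 0"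
    show "diffeo_onto (cball 0 1) (closure D) U"
    proof (rule diffeo_if_det_pos[OF det_pos_if_nonconvex_part_det_pos U_C1])
      show "norm (b z) < norm (a z)" if "z \<in> sphere 0 1" "U z \<in> nonconvex_part D" for z
        using * that U_bdry[OF that(1)] jac[OF sub[OF that(1)]] by simp
    qed
  qed
qed

end
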